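(* Let $k$ be an algebraically closed field of characteristic zero, $R=k\langle x,y\rangle/(xy-yx-y^2)$, let $\rho_n:R\to M_n(k)$ be an arbitrary $n$-dimensional representation of $R$, and let $A_n=\rho_n(R)$ be its image algebra. Then $\dim_k A_n\le \frac{n(n+2)}{4}$ if $n$ is even and $\dim_k A_n\le\frac{(n+1)^2}{4}$ if $n$ is odd. This estimate is optimal: it is attained for the image algebra of a representation for which the Jordan normal form of $Y=\rho_n(y)$ is one full block of size $n$.
   Context: For every finite-dimensional representation $\rho_n$ of $R$ the matrix $\rho_n(y)$ is nilpotent, so the full block is the nilpotent Jordan block of size $n$. *)

theory Defs
  imports
    "Jordan_Normal_Form.Jordan_Normal_Form"
    "Jordan_Normal_Form.VS_Connect"
    "HOL-Library.Poly_Mapping"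
    "HOL-Algebra.QuotRing"
begin

text \<open>
  The free monoid on an alphabet, written additively, so that the convolution product of
  \<^theory>\<open>HOL-Library.Poly_Mapping\<close> on finitely supported functions turns
  \<open>'a free_monoid \<Rightarrow>\<^sub>0 'k\<close> into the free associative algebra over \<open>'k\<close> on \<open>'a\<close>.
\<close>

datatype 'a free_monoid = Word "'a list"

instantiation free_monoid :: (type) monoid_add
begin

definition zero_free_monoid :: "'a free_monoid"
  where "0 = Word []"

fun plus_free_monoid :: "'a free_monoid \<Rightarrow> 'a free_monoid \<Rightarrow> 'a free_monoid"
  where "Word u + Word v = Word (u @ v)"

instance
proof
  fix a b c :: "'a free_monoid"
  show "a + b + c = a + (b + c)"
    by (cases a; cases b; cases c) simp
  show "0 + a = a" "a + 0 = a"
    by (cases a; simp add: zero_free_monoid_def)+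
qed

end

type_synonym ('a, 'k) free_algebra = "'a free_monoid \<Rightarrow>\<^sub>0 'k"

definition free_gen :: "'a \<Rightarrow> ('a, 'k::ring_1) free_algebra"
  where "free_gen g = Poly_Mapping.single (Word [g]) 1"

definition free_scalar :: "'k::ring_1 \<Rightarrow> ('a, 'k) free_algebra"
  where "free_scalar c = Poly_Mapping.single 0 c"

datatype xy = Gx | Gy

text \<open>The two-sided ideal of \<open>k\<langle>x, y\<rangle>\<close> generated by \<open>xy - yx - y\<^sup>2\<close>.\<close>

definition jp_ideal :: "(xy, 'k::field) free_algebra set"
  where "jp_ideal =
    Idl\<^bsub>class_ring\<^esub> {free_gen Gx * free_gen Gy - free_gen Gy * free_gen Gx - (free_gen Gy)\<^sup>2}"

definition jordan_plane :: "(xy, 'k::field) free_algebra set ring"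
  where "jordan_plane = class_ring Quot jp_ideal"

definition jp_class :: "(xy, 'k::field) free_algebra \<Rightarrow> (xy, 'k) free_algebra set"
  where "jp_class p = jp_ideal +>\<^bsub>class_ring\<^esub> p"

definition jp_y :: "(xy, 'k::field) free_algebra set"
  where "jp_y = jp_class (free_gen Gy)"

text \<open>
  Representations on \<open>k\<^sup>n\<close> are homomorphisms of unital \<open>k\<close>-algebras. The ring record
  \<^const>\<open>jordan_plane\<close> has no scalar multiplication, so \<open>c \<cdot> a\<close> is written as the product
  of \<open>a\<close> with the class of the constant \<open>c\<close>. The values of \<open>\<rho>\<close> outside the carrier are
  irrelevant.
\<close>

definition jp_representation ::
  "nat \<Rightarrow> ((xy, 'k::field) free_algebra set \<Rightarrow> 'k mat) \<Rightarrow> bool"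
  where "jp_representation n \<rho> \<longleftrightarrow>
    \<rho> \<in> ring_hom jordan_plane (ring_mat TYPE('k) n ()) \<and>
    (\<forall>c. \<forall>a \<in> carrier jordan_plane.
      \<rho> (jp_class (free_scalar c) \<otimes>\<^bsub>jordan_plane\<^esub> a) = c \<cdot>\<^sub>m \<rho> a)"

definition image_algebra ::
  "((xy, 'k::field) free_algebra set \<Rightarrow> 'k mat) \<Rightarrow> 'k mat set"
  where "image_algebra \<rho> = \<rho> ` carrier jordan_plane"

definition image_dim :: "nat \<Rightarrow> ((xy, 'k::field) free_algebra set \<Rightarrow> 'k mat) \<Rightarrow> nat"
  where "image_dim n \<rho> =
    vectorspace.dim class_ring ((module_mat TYPE('k) n n)\<lparr>carrier := image_algebra \<rho>\<rparr>)"

end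

theory Submission
  imports Defs "Jordan_Normal_Form.Schur_Decomposition" "Jordan_Normal_Form.DL_Rank"
begin

text \<open>
  Write \<open>X\<close> and \<open>Y\<close> for the images of the generators, so that \<open>X Y = Y X + Y\<^sup>2\<close>. Moving \<open>X\<close> to the
  right, the image algebra is spanned by the monomials \<open>Y\<^sup>i X\<^sup>j\<close>, and both bounds in the statement
  are the integer part of \<open>(n + 1)\<^sup>2 / 4\<close>.

  Suppose first that \<open>X\<close> and \<open>Y\<close> are strictly upper triangular. Then a monomial of degree at least
  \<open>m\<close> is supported on or above the \<open>m\<close>-th superdiagonal. Hence the dimension is at most the number
  \<open>m (m + 1) / 2\<close> of monomials of degree below \<open>m\<close> plus the number \<open>(n - m) (n - m + 1) / 2\<close> of the
  positions just described. With \<open>m = n div 2\<close> this is the bound (\<open>alg_bound_strictly_upper\<close>).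

  The general case reduces to this one. A trace argument in characteristic zero shows that \<open>Y\<close> is
  nilpotent (\<open>jordan_pair_nilpotent\<close>). Commutation with \<open>X\<close> sends \<open>Y\<^sup>i\<close> to \<open>i Y\<^sup>i\<^sup>+\<^sup>1\<close>, hence is nilpotent
  on the powers of \<open>Y\<close>, and therefore \<open>Y\<close> preserves the generalized eigenspaces of \<open>X\<close>
  (\<open>jordan_pair_block_diagonal\<close>). On each of them \<open>X\<close> is a nilpotent matrix up to a scalar, which
  does not affect the algebra, and a nilpotent pair has a common kernel vector, so it can be made
  strictly upper triangular (\<open>jordan_pair_strictly_triangularizable\<close>). The algebra embeds into the
  direct sum of the algebras of the blocks, and the bound is superadditive
  (\<open>square_div4_superadditive\<close>).

  For sharpness let \<open>Y\<close> be the full nilpotent block and let \<open>X\<close> have the entries \<open>-1, -2, \<dots>\<close> on the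
  first superdiagonal. In degree \<open>d\<close> the algebra consists of the matrices on the \<open>d\<close>-th
  superdiagonal whose entries are the values of a polynomial of degree at most \<open>d\<close> at \<open>n - d\<close>
  points. This gives \<open>min (d + 1) (n - d)\<close> dimensions in each degree \<open>d < n\<close>, and
  the sum over \<open>d\<close> is the bound. Independence is read off from the elements
  \<open>Y\<^sup>d\<^sup>-\<^sup>j (X + d Y)\<^sup>j\<close>, which have a triangular pattern of entries (\<open>full_block_product\<close>).
\<close>

section \<open>Linear spans and algebras of matrices\<close>

lemma mult_carrier_square [simp]:
  "A \<in> carrier_mat n n \<Longrightarrow> B \<in> carrier_mat n n \<Longrightarrow> A * B \<in> carrier_mat n n"
  by (rule mult_carrier_mat)

lemma mult_assoc_square:
  "A \<in> carrier_mat n n \<Longrightarrow> B \<in> carrier_mat n n \<Longrightarrow> C \<in> carrier_mat n n \<Longrightarrow>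
    A * B * C = A * (B * C)"
  by (rule assoc_mult_mat)

text \<open>
  The linear span is generated inductively, so that compatibility with linear maps follows by rule
  induction, without coefficient functions.
\<close>

inductive_set mat_span :: "nat \<Rightarrow> 'k::field mat set \<Rightarrow> 'k mat set" for n B where
  zero: "0\<^sub>m n n \<in> mat_span n B"
| gen: "b \<in> B \<Longrightarrow> b \<in> mat_span n B"
| add: "a \<in> mat_span n B \<Longrightarrow> b \<in> mat_span n B \<Longrightarrow> a + b \<in> mat_span n B"
| smult: "a \<in> mat_span n B \<Longrightarrow> c \<cdot>\<^sub>m a \<in> mat_span n B"

text \<open>
  Words are built by multiplication on the left only, which already yields the unital algebra
  generated by \<open>X\<close> and \<open>Y\<close>. The zero matrix arises by scaling \<open>1\<close>.
\<close>

inductive_set gen_alg :: "nat \<Rightarrow> 'k::field mat \<Rightarrow> 'k mat \<Rightarrow> 'k mat set" for n X Y where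
  one: "1\<^sub>m n \<in> gen_alg n X Y"
| add: "a \<in> gen_alg n X Y \<Longrightarrow> b \<in> gen_alg n X Y \<Longrightarrow> a + b \<in> gen_alg n X Y"
| smult: "a \<in> gen_alg n X Y \<Longrightarrow> c \<cdot>\<^sub>m a \<in> gen_alg n X Y"
| multX: "a \<in> gen_alg n X Y \<Longrightarrow> X * a \<in> gen_alg n X Y"
| multY: "a \<in> gen_alg n X Y \<Longrightarrow> Y * a \<in> gen_alg n X Y"

lemma mat_span_carrier: "a \<in> mat_span n B \<Longrightarrow> B \<subseteq> carrier_mat n n \<Longrightarrow> a \<in> carrier_mat n n"
  by (induction rule: mat_span.induct) auto

lemma gen_alg_carrier:
  assumes "a \<in> gen_alg n X Y" "X \<in> carrier_mat n n" "Y \<in> carrier_mat n n"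
  shows "a \<in> carrier_mat n n"
  using assms by (induction rule: gen_alg.induct) auto

lemma mat_span_mono: "a \<in> mat_span n B \<Longrightarrow> B \<subseteq> C \<Longrightarrow> a \<in> mat_span n C"
  by (induction rule: mat_span.induct) (auto intro: mat_span.intros)

lemma mat_span_linear_image:
  assumes "a \<in> mat_span n B" "B \<subseteq> carrier_mat n n" "f (0\<^sub>m n n) = 0\<^sub>m m m"
    "\<And>a b. a \<in> carrier_mat n n \<Longrightarrow> b \<in> carrier_mat n n \<Longrightarrow> f (a + b) = f a + f b"
    "\<And>a c. a \<in> carrier_mat n n \<Longrightarrow> f (c \<cdot>\<^sub>m a) = c \<cdot>\<^sub>m f a"
    "\<And>b. b \<in> B \<Longrightarrow> f b \<in> mat_span m C"
  shows "f a \<in> mat_span m C"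
  using assms
proof (induction rule: mat_span.induct)
  case (add a b)
  then have "a \<in> carrier_mat n n" "b \<in> carrier_mat n n" by (auto intro: mat_span_carrier)
  with add show ?case by (auto intro: mat_span.add)
next
  case (smult a c)
  then have "a \<in> carrier_mat n n" by (auto intro: mat_span_carrier)
  with smult show ?case by (auto intro: mat_span.smult)
qed (auto intro: mat_span.intros)

lemma mat_span_mult_left:
  assumes "a \<in> mat_span n B" "B \<subseteq> carrier_mat n n" "X \<in> carrier_mat n n"
    "\<And>b. b \<in> B \<Longrightarrow> X * b \<in> mat_span n C"
  shows "X * a \<in> mat_span n C"
  by (rule mat_span_linear_image[where f = "(*) X", OF assms(1,2)])
    (use assms in \<open>auto simp: mult_add_distrib_mat[of _ n n] mult_smult_distrib[of _ n n]\<close>)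

definition elem_mat :: "nat \<Rightarrow> nat \<times> nat \<Rightarrow> 'k::field mat"
  where "elem_mat n p = mat n n (\<lambda>q. if q = p then 1 else 0)"

lemma mat_span_elem_mat:
  assumes "finite S" "A \<in> carrier_mat n n"
    "\<And>i j. i < n \<Longrightarrow> j < n \<Longrightarrow> (i, j) \<notin> S \<Longrightarrow> A $$ (i, j) = 0"
  shows "A \<in> mat_span n (elem_mat n ` S)"
  using assms
proof (induction S arbitrary: A rule: finite_induct)
  case empty
  then have "A = 0\<^sub>m n n" by auto
  then show ?case by (simp add: mat_span.zero)
next
  case (insert p S)
  let ?A = "mat n n (\<lambda>q. if q = p then 0 else A $$ q)"
  have "?A \<in> mat_span n (elem_mat n ` S)"
    by (rule insert.IH) (use insert.prems in auto)
  then have "?A \<in> mat_span n (elem_mat n ` insert p S)"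
    by (rule mat_span_mono) auto
  moreover have "(A $$ p) \<cdot>\<^sub>m elem_mat n p \<in> mat_span n (elem_mat n ` insert p S)"
    by (intro mat_span.smult mat_span.gen) auto
  ultimately have "?A + (A $$ p) \<cdot>\<^sub>m elem_mat n p \<in> mat_span n (elem_mat n ` insert p S)"
    by (rule mat_span.add)
  also have "?A + (A $$ p) \<cdot>\<^sub>m elem_mat n p = A"
    using insert.prems(1) by (intro eq_matI) (auto simp: elem_mat_def)
  finally show ?case .
qed

text \<open>
  A dimension bound in a form that survives embedding into larger matrices: the spanning set
  may lie outside the algebra. So only inclusions have to be proved until the very end.
\<close>

definition alg_bound :: "nat \<Rightarrow> 'k::field mat \<Rightarrow> 'k mat \<Rightarrow> nat \<Rightarrow> bool"
  where "alg_bound n X Y c \<longleftrightarrow> (\<exists>B. finite B \<and> B \<subseteq> carrier_mat n n \<and> card B \<le> c \<and>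
    gen_alg n X Y \<subseteq> mat_span n B)"

lemma gen_alg_subset_spanI:
  assumes "X \<in> carrier_mat n n" "Y \<in> carrier_mat n n" "B \<subseteq> carrier_mat n n"
    "1\<^sub>m n \<in> mat_span n B"
    "\<And>b. b \<in> B \<Longrightarrow> X * b \<in> mat_span n B" "\<And>b. b \<in> B \<Longrightarrow> Y * b \<in> mat_span n B"
  shows "gen_alg n X Y \<subseteq> mat_span n B"
proof
  fix a assume "a \<in> gen_alg n X Y"
  then show "a \<in> mat_span n B"
    using assms
    by (induction rule: gen_alg.induct) (auto intro: mat_span.intros mat_span_mult_left)
qed

text \<open>
  Membership in the \<open>d\<close>-th power of the algebra of strictly upper triangular matrices; for
  \<open>d = 0\<close> these are all upper triangular ones.
\<close>

definition band :: "nat \<Rightarrow> nat \<Rightarrow> 'k::field mat \<Rightarrow> bool"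
  where "band n d A \<longleftrightarrow> A \<in> carrier_mat n n \<and> (\<forall>i<n. \<forall>j<n. j < i + d \<longrightarrow> A $$ (i, j) = 0)"

lemma band_mult:
  assumes "band n d A" "band n e B"
  shows "band n (d + e) (A * B)"
proof -
  have "(A * B) $$ (i, j) = 0" if ij: "i < n" "j < n" "j < i + (d + e)" for i j
  proof -
    have "(A * B) $$ (i, j) = (\<Sum>k<n. A $$ (i, k) * B $$ (k, j))"
      using assms ij by (auto simp: band_def scalar_prod_def lessThan_atLeast0)
    also have "\<dots> = 0"
    proof (intro sum.neutral ballI)
      fix k assume k: "k \<in> {..<n}"
      show "A $$ (i, k) * B $$ (k, j) = 0"
      proof (cases "k < i + d")
        case True
        then show ?thesis using assms ij k by (auto simp: band_def)
      next
        case False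
        then have "j < k + e" using ij by linarith
        then show ?thesis using assms ij k by (auto simp: band_def)
      qed
    qed
    finally show ?thesis .
  qed
  then show ?thesis using assms by (auto simp: band_def)
qed

lemma band_pow: "band n 1 A \<Longrightarrow> band n k (A ^\<^sub>m k)"
proof (induction k)
  case 0
  then show ?case by (auto simp: band_def)
next
  case (Suc k)
  then show ?case using band_mult[of n k "A ^\<^sub>m k" 1 A] by simp
qed

lemma band_mono: "band n d A \<Longrightarrow> e \<le> d \<Longrightarrow> band n e A"
  by (auto simp: band_def)

section \<open>Pairs of strictly upper triangular matrices\<close>

text \<open>
  The defining relation of the Jordan plane, written without subtraction.
\<close>

definition jordan_pair :: "nat \<Rightarrow> 'k::field mat \<Rightarrow> 'k mat \<Rightarrow> bool"
  where "jordan_pair n X Y \<longleftrightarrow>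
    X \<in> carrier_mat n n \<and> Y \<in> carrier_mat n n \<and> X * Y = Y * X + Y * Y"

lemma pow_mat_Suc_left:
  assumes "A \<in> carrier_mat n n"
  shows "A ^\<^sub>m Suc k = A * A ^\<^sub>m k"
proof (induction k)
  case (Suc k)
  have "A ^\<^sub>m Suc (Suc k) = A * A ^\<^sub>m k * A" using Suc by simp
  also have "\<dots> = A * A ^\<^sub>m Suc k"
    using assms by (simp add: mult_assoc_square[of _ n])
  finally show ?case .
qed (use assms in simp)

text \<open>
  Commutation with \<open>X\<close> acts on polynomials in \<open>Y\<close> as the derivation \<open>Y\<^sup>2 \<cdot> d/dY\<close>. This is what
  lets \<open>X\<close> be moved across powers of \<open>Y\<close>.
\<close>

lemma jordan_pair_mult_pow:
  assumes "jordan_pair n X Y"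
  shows "X * Y ^\<^sub>m k = Y ^\<^sub>m k * X + of_nat k \<cdot>\<^sub>m Y ^\<^sub>m Suc k"
proof (induction k)
  case 0
  then show ?case using assms by (auto simp: jordan_pair_def)
next
  case (Suc k)
  from assms have [simp]: "X \<in> carrier_mat n n" "Y \<in> carrier_mat n n"
    and XY: "X * Y = Y * X + Y * Y" by (auto simp: jordan_pair_def)
  let ?P = "Y ^\<^sub>m k"
  have P[simp]: "?P \<in> carrier_mat n n" by simp
  have "X * Y ^\<^sub>m Suc k = (X * ?P) * Y"
    by (simp add: mult_assoc_square[of _ n])
  also have "\<dots> = ?P * X * Y + of_nat k \<cdot>\<^sub>m (?P * Y * Y)"
    unfolding Suc
    by (subst add_mult_distrib_mat[of _ n n _ _ n]) (auto simp: mult_smult_assoc_mat[of _ n n _ n])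
  also have "?P * X * Y = ?P * (Y * X + Y * Y)"
    by (simp add: mult_assoc_square[of _ n] XY)
  also have "\<dots> = ?P * Y * X + ?P * Y * Y"
    by (subst mult_add_distrib_mat[of _ n n _ n]) (auto simp: mult_assoc_square[of _ n])
  also have "\<dots> + of_nat k \<cdot>\<^sub>m (?P * Y * Y) = ?P * Y * X + of_nat (Suc k) \<cdot>\<^sub>m (?P * Y * Y)"
    by (intro eq_matI) (auto simp: algebra_simps simp del: index_mult_mat(1))
  finally show ?case by simp
qed

lemma jordan_pair_mult_monomial:
  assumes pair: "jordan_pair n X Y"
  shows "X * (Y ^\<^sub>m i * X ^\<^sub>m j) = Y ^\<^sub>m i * X ^\<^sub>m Suc j + of_nat i \<cdot>\<^sub>m (Y ^\<^sub>m Suc i * X ^\<^sub>m j)"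
proof -
  from assms have [simp]: "X \<in> carrier_mat n n" "Y \<in> carrier_mat n n"
    by (auto simp: jordan_pair_def)
  have "X * (Y ^\<^sub>m i * X ^\<^sub>m j) = (X * Y ^\<^sub>m i) * X ^\<^sub>m j"
    by (simp add: mult_assoc_square[of _ n])
  also have "\<dots> = Y ^\<^sub>m i * X * X ^\<^sub>m j + of_nat i \<cdot>\<^sub>m (Y ^\<^sub>m Suc i * X ^\<^sub>m j)"
    unfolding jordan_pair_mult_pow[OF pair]
    by (subst add_mult_distrib_mat[of _ n n _ _ n])
      (auto simp: mult_smult_assoc_mat[of _ n n _ n])
  also have "Y ^\<^sub>m i * X * X ^\<^sub>m j = Y ^\<^sub>m i * X ^\<^sub>m Suc j"
    using pow_mat_Suc_left[of X n j] by (simp add: mult_assoc_square[of _ n])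
  finally show ?thesis .
qed

lemma card_triangle: "2 * card {(i, j). i + j < (k::nat)} = k * (k + 1)"
proof -
  have "{(i, j). i + j < k} = Sigma {..<k} (\<lambda>i. {..<k - i})" by auto
  then have "card {(i, j). i + j < k} = (\<Sum>i<k. k - i)" by simp
  also have "\<dots> = (\<Sum>i<k. Suc i)"
    by (rule sum.reindex_bij_witness[of _ "\<lambda>i. k - Suc i" "\<lambda>i. k - Suc i"]) auto
  also have "2 * \<dots> = k * (k + 1)" by (induction k) auto
  finally show ?thesis .
qed

lemma finite_triangle [simp]: "finite {(i, j). i + j < (k::nat)}"
  by (rule finite_subset[of _ "{..<k} \<times> {..<k}"]) auto

lemma odd_square_div4: "(2 * k + 1)\<^sup>2 div 4 = k * (k + 1 :: nat)"
proof -
  have "(2 * k + 1)\<^sup>2 = 4 * (k * (k + 1)) + 1" by (simp add: power2_eq_square algebra_simps)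
  then show ?thesis by simp
qed

lemma even_square_div4: "(2 * k + 2)\<^sup>2 div 4 = (k + 1) * (k + 1 :: nat)"
proof -
  have "(2 * k + 2)\<^sup>2 = 4 * ((k + 1) * (k + 1))" by (simp add: power2_eq_square algebra_simps)
  then show ?thesis by simp
qed

text \<open>
  The algebra is spanned by the monomials \<open>Y\<^sup>i X\<^sup>j\<close>. There are few of them of degree below
  \<open>m\<close>, namely \<open>m (m + 1) / 2\<close>, and all the others lie in the space of matrices supported on or
  above the \<open>m\<close>-th superdiagonal, of dimension \<open>(n - m) (n - m + 1) / 2\<close>. For \<open>m\<close> about half of
  \<open>n\<close> the two numbers add up to the bound.
\<close>

lemma alg_bound_strictly_upper:
  assumes pair: "jordan_pair n X Y" and X1: "band n 1 X" and Y1: "band n 1 Y"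
  shows "alg_bound n X Y ((n + 1)\<^sup>2 div 4)"
proof -
  from pair have [simp]: "X \<in> carrier_mat n n" "Y \<in> carrier_mat n n"
    by (auto simp: jordan_pair_def)
  define m where "m = n div 2"
  \<comment> \<open>Any cut-off gives a spanning set; cutting in the middle minimises its size.\<close>
  let ?mon = "\<lambda>(i, j). Y ^\<^sub>m i * X ^\<^sub>m j"
  define B1 where "B1 = ?mon ` {(i, j). i + j < m}"
  \<comment> \<open>These are the positions on or above the m-th superdiagonal, reindexed by a triangle of side n - m.\<close>
  define S where "S = (\<lambda>(i, j). (i, n - 1 - j)) ` {(i, j). i + j < n - m}"
  let ?E = "elem_mat n ` S :: 'a mat set"
  let ?B = "B1 \<union> ?E"
  have B: "?B \<subseteq> carrier_mat n n" by (auto simp: B1_def elem_mat_def)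
  have finS: "finite S" unfolding S_def by (intro finite_imageI finite_triangle)
  have high: "A \<in> mat_span n ?B" if "band n m A" for A
  proof -
    have "A \<in> mat_span n ?E"
    proof (rule mat_span_elem_mat[OF finS])
      fix i j assume ij: "i < n" "j < n" "(i, j) \<notin> S"
      have "j < i + m"
      proof (rule ccontr)
        assume "\<not> j < i + m"
        then have "(i, j) \<in> S" unfolding S_def using ij
          by (intro image_eqI[of _ _ "(i, n - 1 - j)"]) auto
        with ij show False by simp
      qed
      with that ij show "A $$ (i, j) = 0" by (auto simp: band_def)
    qed (use that in \<open>auto simp: band_def\<close>)
    then show ?thesis by (rule mat_span_mono) auto
  qed
  have bmon: "band n (i + j) (?mon (i, j))" for i j
    using band_mult[OF band_pow[OF Y1] band_pow[OF X1]] by simp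
  have mon: "?mon (i, j) \<in> mat_span n ?B" for i j
  proof (cases "i + j < m")
    case True
    then have "?mon (i, j) \<in> B1" unfolding B1_def by blast
    then show ?thesis by (auto intro: mat_span.gen)
  next
    case False
    then show ?thesis by (intro high band_mono[OF bmon[of i j]]) simp
  qed
  have Xmon: "X * ?mon (i, j) = ?mon (i, Suc j) + of_nat i \<cdot>\<^sub>m ?mon (Suc i, j)" for i j
    using jordan_pair_mult_monomial[OF pair] by simp
  have Ymon: "Y * ?mon (i, j) = ?mon (Suc i, j)" for i j
    using pow_mat_Suc_left[of Y n i] by (simp add: mult_assoc_square[of _ n])
  have belem: "band n m (elem_mat n s :: 'a mat)" if "s \<in> S" for s
    using that by (auto simp: S_def elem_mat_def band_def)
  have "gen_alg n X Y \<subseteq> mat_span n ?B"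
  proof (rule gen_alg_subset_spanI[OF _ _ B])
    show "1\<^sub>m n \<in> mat_span n ?B" using mon[of 0 0] pair carrier_matD(1)[of X n n] carrier_matD(1)[of Y n n] by simp
  next
    fix b assume "b \<in> ?B"
    then consider i j where "b = ?mon (i, j)" | s where "s \<in> S" "b = elem_mat n s"
      unfolding B1_def by auto
    then show "X * b \<in> mat_span n ?B"
    proof cases
      case 1
      show ?thesis unfolding 1 Xmon by (intro mat_span.add mat_span.smult mon)
    next
      case 2
      show ?thesis unfolding 2
        by (intro high band_mono[OF band_mult[OF X1 belem[OF 2(1)]]]) simp
    qed
  next
    fix b assume "b \<in> ?B"
    then consider i j where "b = ?mon (i, j)" | s where "s \<in> S" "b = elem_mat n s"
      unfolding B1_def by auto
    then show "Y * b \<in> mat_span n ?B"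
    proof cases
      case 1
      show ?thesis unfolding 1 Ymon by (intro mon)
    next
      case 2
      show ?thesis unfolding 2
        by (intro high band_mono[OF band_mult[OF Y1 belem[OF 2(1)]]]) simp
    qed
  qed auto
  moreover have "finite ?B" unfolding B1_def using finS by auto
  moreover have "card ?B \<le> (n + 1)\<^sup>2 div 4"
  proof -
    have "card ?B \<le> card B1 + card ?E" by (rule card_Un_le)
    moreover have "card B1 \<le> card {(i, j). i + j < m}"
      unfolding B1_def by (rule card_image_le) simp
    moreover have "card ?E \<le> card S" by (rule card_image_le[OF finS])
    moreover have "card S \<le> card {(i, j). i + j < n - m}"
      unfolding S_def by (rule card_image_le) simp
    ultimately have "2 * card ?B \<le> m * (m + 1) + (n - m) * (n - m + 1)"
      using card_triangle[of m] card_triangle[of "n - m"] by linarith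
    moreover have "m * (m + 1) + (n - m) * (n - m + 1) = 2 * ((n + 1)\<^sup>2 div 4)"
    proof (cases "even n")
      case True
      then obtain k where k: "n = 2 * k" by (elim evenE)
      then show ?thesis using odd_square_div4[of k] by (simp add: m_def)
    next
      case False
      then obtain k where k: "n = 2 * k + 1" by (elim oddE)
      have "m = k" "n - m = k + 1" by (auto simp: k m_def)
      then show ?thesis using even_square_div4[of k] by (simp add: k algebra_simps)
    qed
    ultimately show ?thesis by linarith
  qed
  ultimately show ?thesis using B unfolding alg_bound_def by blast
qed

section \<open>Splitting off the nilpotent part of a matrix\<close>

abbreviation diag2 :: "nat \<Rightarrow> nat \<Rightarrow> 'a::zero mat \<Rightarrow> 'a mat \<Rightarrow> 'a mat"
  where "diag2 a b A D \<equiv> four_block_mat A (0\<^sub>m a b) (0\<^sub>m b a) D"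

lemma four_block_mat_inject:
  assumes "four_block_mat A B C D = four_block_mat A' B' C' D'"
    "A \<in> carrier_mat a c" "B \<in> carrier_mat a d" "C \<in> carrier_mat b c" "D \<in> carrier_mat b d"
    "A' \<in> carrier_mat a c" "B' \<in> carrier_mat a d" "C' \<in> carrier_mat b c" "D' \<in> carrier_mat b d"
  shows "A = A' \<and> B = B' \<and> C = C' \<and> D = D'"
proof -
  have *: "four_block_mat A B C D $$ (i, j) = four_block_mat A' B' C' D' $$ (i, j)" for i j
    using assms(1) by simp
  have "A = A'"
  proof (rule eq_matI)
    fix i j assume "i < dim_row A'" "j < dim_col A'"
    then show "A $$ (i, j) = A' $$ (i, j)" using *[of i j] assms(2-) by auto
  qed (use assms in auto)
  moreover have "B = B'"
  proof (rule eq_matI)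
    fix i j assume "i < dim_row B'" "j < dim_col B'"
    then show "B $$ (i, j) = B' $$ (i, j)" using *[of i "c + j"] assms(2-) by auto
  qed (use assms in auto)
  moreover have "C = C'"
  proof (rule eq_matI)
    fix i j assume "i < dim_row C'" "j < dim_col C'"
    then show "C $$ (i, j) = C' $$ (i, j)" using *[of "a + i" j] assms(2-) by auto
  qed (use assms in auto)
  moreover have "D = D'"
  proof (rule eq_matI)
    fix i j assume "i < dim_row D'" "j < dim_col D'"
    then show "D $$ (i, j) = D' $$ (i, j)" using *[of "a + i" "c + j"] assms(2-) by auto
  qed (use assms in auto)
  ultimately show ?thesis by simp
qed

lemma four_block_mat_cases:
  assumes "A \<in> carrier_mat (a + b) (c + d)"
  obtains B C D E where "A = four_block_mat B C D E"
    "B \<in> carrier_mat a c" "C \<in> carrier_mat a d" "D \<in> carrier_mat b c" "E \<in> carrier_mat b d"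
proof -
  obtain B C D E where s: "split_block A a c = (B, C, D, E)" by (cases "split_block A a c") auto
  from assms have "dim_row A = a + b" "dim_col A = c + d" by auto
  from split_block[OF s this] show ?thesis by (intro that)
qed

text \<open>
  Only the diagonal blocks of a power matter below: they show that nilpotency passes
  between a block triangular matrix and its diagonal blocks.
\<close>

lemma pow_block_upper_triangular:
  assumes "A \<in> carrier_mat a a" "B \<in> carrier_mat a b" "D \<in> carrier_mat b b"
  shows "\<exists>C\<in>carrier_mat a b. four_block_mat A B (0\<^sub>m b a) D ^\<^sub>m k =
    four_block_mat (A ^\<^sub>m k) C (0\<^sub>m b a) (D ^\<^sub>m k)"
proof (induction k)
  case 0
  show ?case using assms by (intro bexI[of _ "0\<^sub>m a b"]) auto
next
  case (Suc k)
  then obtain C where C: "C \<in> carrier_mat a b"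
    "four_block_mat A B (0\<^sub>m b a) D ^\<^sub>m k = four_block_mat (A ^\<^sub>m k) C (0\<^sub>m b a) (D ^\<^sub>m k)"
    by blast
  have "four_block_mat A B (0\<^sub>m b a) D ^\<^sub>m Suc k =
      four_block_mat (A ^\<^sub>m Suc k) (A ^\<^sub>m k * B + C * D) (0\<^sub>m b a) (D ^\<^sub>m Suc k)"
    using assms C
    by (simp add: mult_four_block_mat[of _ a a _ b _ b _ _ a _ b])
  then show ?case using assms C
    by (intro bexI[of _ "A ^\<^sub>m k * B + C * D"]) auto
qed

lemma pow_mat_eq_zero_mono:
  assumes "A \<in> carrier_mat n n" "A ^\<^sub>m k = 0\<^sub>m n n" "k \<le> l"
  shows "A ^\<^sub>m l = 0\<^sub>m n n"
  using assms(3)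
proof (induction l rule: dec_induct)
  case base
  then show ?case by (fact assms(2))
qed (use assms(1) in simp)

lemma nilpotent_block_upper_triangular:
  assumes "A \<in> carrier_mat a a" "B \<in> carrier_mat a b" "D \<in> carrier_mat b b"
    "A ^\<^sub>m p = 0\<^sub>m a a" "D ^\<^sub>m q = 0\<^sub>m b b"
  shows "\<exists>k. four_block_mat A B (0\<^sub>m b a) D ^\<^sub>m k = 0\<^sub>m (a + b) (a + b)"
proof -
  let ?k = "p + q" and ?T = "four_block_mat A B (0\<^sub>m b a) D"
  have "A ^\<^sub>m ?k = 0\<^sub>m a a" "D ^\<^sub>m ?k = 0\<^sub>m b b"
    using assms by (auto intro: pow_mat_eq_zero_mono[of _ _ p] pow_mat_eq_zero_mono[of _ _ q])
  with pow_block_upper_triangular[OF assms(1-3), of ?k]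
  obtain C where C: "C \<in> carrier_mat a b"
    "?T ^\<^sub>m ?k = four_block_mat (0\<^sub>m a a) C (0\<^sub>m b a) (0\<^sub>m b b)"
    by auto
  have T: "?T ^\<^sub>m ?k \<in> carrier_mat (a + b) (a + b)" using assms by simp
  have "?T ^\<^sub>m ?k * ?T ^\<^sub>m ?k = 0\<^sub>m (a + b) (a + b)"
    unfolding C(2) using C(1) by (simp add: mult_four_block_mat[of _ a a _ b _ b _ _ a _ b])
  moreover have "?T ^\<^sub>m (?k + l) = ?T ^\<^sub>m ?k * ?T ^\<^sub>m l" for l
  proof (induction l)
    case 0
    show ?case using assms T by auto
  next
    case (Suc l)
    have "?T \<in> carrier_mat (a + b) (a + b)" using assms by simp
    then show ?case using Suc by (simp add: mult_assoc_square[of _ "a + b"])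
  qed
  ultimately show ?thesis by metis
qed

lemma exists_invertible_first_col:
  fixes v :: "'k::field vec"
  assumes v: "v \<in> carrier_vec n" "v \<noteq> 0\<^sub>v n"
  obtains P Q where "P \<in> carrier_mat n n" "Q \<in> carrier_mat n n"
    "P * Q = 1\<^sub>m n" "Q * P = 1\<^sub>m n" "col P 0 = v"
proof -
  interpret vec_space "TYPE('k)" n .
  note b = basis_completion[OF v]
  let ?b = "basis_completion v"
  let ?P = "mat_of_cols n ?b"
  have n0: "n \<noteq> 0" using v by auto
  have P: "?P \<in> carrier_mat n n" using b(6) mat_of_cols_carrier(1)[of n ?b] by simp
  have cols: "cols ?P = ?b" by (rule cols_mat_of_cols[OF b(2)])
  have "rank ?P = n" by (rule lin_indpt_full_rank[OF P]) (use cols b in auto)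
  then have "det ?P \<noteq> 0" using det_rank_iff[OF P] by simp
  from det_non_zero_imp_unit[OF P this, of "()"]
  obtain Q where Q: "Q \<in> carrier_mat n n" "Q * ?P = 1\<^sub>m n" "?P * Q = 1\<^sub>m n"
    by (auto simp: Units_def ring_mat_simps)
  have "col ?P 0 = ?b ! 0" using b n0 by (intro col_mat_of_cols) (auto simp: set_conv_nth subset_iff)
  also have "\<dots> = v" using b(6,7) n0 by (metis hd_conv_nth length_0_conv)
  finally show ?thesis using that[OF P Q(1) Q(3) Q(2)] by simp
qed

text \<open>
  In a basis that starts with a vector of the kernel, the first column vanishes. This is the
  reduction step of both inductions on the size below.
\<close>

lemma kernel_vector_conj_block:
  fixes A :: "'k::field mat"
  assumes A: "A \<in> carrier_mat (Suc m) (Suc m)" and P: "P \<in> carrier_mat (Suc m) (Suc m)"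
    and Q: "Q \<in> carrier_mat (Suc m) (Suc m)" and QP: "Q * P = 1\<^sub>m (Suc m)"
    and Av: "A *\<^sub>v col P 0 = 0\<^sub>v (Suc m)"
  obtains r A' where "r \<in> carrier_mat 1 m" "A' \<in> carrier_mat m m"
    "Q * A * P = four_block_mat (0\<^sub>m 1 1) r (0\<^sub>m m 1) A'"
proof -
  have QAP: "Q * A * P \<in> carrier_mat (1 + m) (1 + m)" using A P Q by simp
  obtain B C D E where bl: "Q * A * P = four_block_mat B C D E"
    "B \<in> carrier_mat 1 1" "C \<in> carrier_mat 1 m" "D \<in> carrier_mat m 1" "E \<in> carrier_mat m m"
    by (rule four_block_mat_cases[OF QAP])
  have "col (Q * A * P) 0 = (Q * A) *\<^sub>v col P 0"
    using A P Q by (intro col_mult2[of _ "Suc m" "Suc m" _ "Suc m"]) auto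
  also have "\<dots> = Q *\<^sub>v (A *\<^sub>v col P 0)"
    using A P Q by (intro assoc_mult_mat_vec[of _ "Suc m" "Suc m" _ "Suc m"]) (auto intro: col_carrier_vec)
  also have "\<dots> = 0\<^sub>v (Suc m)" unfolding Av using Q by auto
  finally have c0: "col (Q * A * P) 0 = 0\<^sub>v (Suc m)" .
  have e0: "(Q * A * P) $$ (i, 0) = 0" if "i < Suc m" for i
    using arg_cong[OF c0, of "\<lambda>v. v $ i"] that QAP index_col[of i "Q * A * P" 0] P Q
    by (auto dest!: carrier_matD simp del: index_mult_mat(1) col_mult2)
  have "B = 0\<^sub>m 1 1" using e0[of 0] bl by (intro eq_matI) auto
  moreover have "D = 0\<^sub>m m 1"
  proof (rule eq_matI)
    fix i j assume "i < dim_row (0\<^sub>m m 1)" "j < dim_col (0\<^sub>m m 1)"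
    then show "D $$ (i, j) = 0\<^sub>m m 1 $$ (i, j)" using e0[of "Suc i"] bl by auto
  qed (use bl in auto)
  ultimately show ?thesis using that[OF bl(3,5)] bl(1) by simp
qed

text \<open>
  Conjugation with a unipotent block matrix removes the corner \<open>C\<close> as soon as
  \<open>Z U - M Z = C\<close> is solvable; here \<open>M Z\<close> is even zero.
\<close>

lemma similar_block_upper_triangular:
  fixes M :: "'k::field mat"
  assumes M: "M \<in> carrier_mat a a" and U: "U \<in> carrier_mat b b" and Z: "Z \<in> carrier_mat a b"
    and MZ: "M * Z = 0\<^sub>m a b" and ZU: "Z * U = C"
  shows "similar_mat (four_block_mat M C (0\<^sub>m b a) U) (diag2 a b M U)"
proof -
  let ?T = "four_block_mat (1\<^sub>m a) Z (0\<^sub>m b a) (1\<^sub>m b)"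
  let ?T' = "four_block_mat (1\<^sub>m a) (- Z) (0\<^sub>m b a) (1\<^sub>m b)"
  note mult = mult_four_block_mat[of _ a a _ b _ b _ _ a _ b]
  have mZ: "- Z \<in> carrier_mat a b" using Z by auto
  have C: "C \<in> carrier_mat a b" using Z U ZU by auto
  have [simp]: "Z + - Z = 0\<^sub>m a b" "- Z + Z = 0\<^sub>m a b" using Z by auto
  have [simp]: "- 0\<^sub>m c d = (0\<^sub>m c d :: 'k mat)" for c d by auto
  have TT: "?T * ?T' = 1\<^sub>m (a + b)" "?T' * ?T = 1\<^sub>m (a + b)"
    using Z mZ by (auto simp: mult)
  have "?T * diag2 a b M U = four_block_mat M C (0\<^sub>m b a) U"
    using M Z U C ZU by (simp add: mult)
  moreover have "M * (- Z) = 0\<^sub>m a b"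
    using M Z MZ by (simp add: uminus_mult_right_mat)
  then have "four_block_mat M C (0\<^sub>m b a) U * ?T' = four_block_mat M C (0\<^sub>m b a) U"
    using M C mZ U by (simp add: mult)
  ultimately have eq: "four_block_mat M C (0\<^sub>m b a) U = ?T * diag2 a b M U * ?T'" by simp
  have "similar_mat_wit (four_block_mat M C (0\<^sub>m b a) U) (diag2 a b M U) ?T ?T'"
    by (rule similar_mat_witI[OF TT eq]) (use M C U in auto)
  then show ?thesis unfolding similar_mat_def by blast
qed

text \<open>
  Fitting's lemma, valid over every field. A singular matrix is brought into block form with
  a vanishing first column; the induction hypothesis splits the remaining block, and the first row
  can be cleared beside the invertible part because that part can be divided by.
\<close>

lemma fitting_decomposition:
  fixes A :: "'k::field mat"
  assumes "A \<in> carrier_mat n n"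
  shows "\<exists>a b M U V k. a + b = n \<and> M \<in> carrier_mat a a \<and> M ^\<^sub>m k = 0\<^sub>m a a \<and>
    U \<in> carrier_mat b b \<and> V \<in> carrier_mat b b \<and> U * V = 1\<^sub>m b \<and> V * U = 1\<^sub>m b \<and>
    similar_mat A (diag2 a b M U)"
  using assms
proof (induction n arbitrary: A)
  case 0
  then have A: "A = 0\<^sub>m 0 0" by auto
  show ?case
    by (intro exI[of _ 0] exI[of _ "0\<^sub>m 0 0"]) (auto simp: A intro!: similar_mat_refl[of _ 0])
next
  case (Suc m)
  note A = Suc.prems
  show ?case
  proof (cases "det A = 0")
    case False
    from det_non_zero_imp_unit[OF A this, of "()"]
    obtain V where V: "V \<in> carrier_mat (Suc m) (Suc m)" "V * A = 1\<^sub>m (Suc m)" "A * V = 1\<^sub>m (Suc m)"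
      by (auto simp: Units_def ring_mat_simps)
    have "diag2 0 (Suc m) (0\<^sub>m 0 0) A = A" using A by (intro eq_matI) auto
    then have "similar_mat A (diag2 0 (Suc m) (0\<^sub>m 0 0) A)" using similar_mat_refl[OF A] by simp
    then show ?thesis using A V
      by (intro exI[of _ "0\<^sub>m 0 0"] exI[of _ A] exI[of _ V] exI[of _ 0] exI[of _ "Suc m"]) auto
  next
    case True
    then obtain v where v: "v \<in> carrier_vec (Suc m)" "v \<noteq> 0\<^sub>v (Suc m)" "A *\<^sub>v v = 0\<^sub>v (Suc m)"
      using det_0_iff_vec_prod_zero_field[OF A] by blast
    obtain P Q where PQ: "P \<in> carrier_mat (Suc m) (Suc m)" "Q \<in> carrier_mat (Suc m) (Suc m)"
      "P * Q = 1\<^sub>m (Suc m)" "Q * P = 1\<^sub>m (Suc m)" "col P 0 = v"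
      by (rule exists_invertible_first_col[OF v(1,2)])
    obtain r A' where r: "r \<in> carrier_mat 1 m" and A': "A' \<in> carrier_mat m m"
      and QAP: "Q * A * P = four_block_mat (0\<^sub>m 1 1) r (0\<^sub>m m 1) A'"
      by (rule kernel_vector_conj_block[OF A PQ(1,2,4)]) (use v PQ in auto)
    have "similar_mat_wit (Q * A * P) A Q P"
      by (rule similar_mat_witI[of _ _ "Suc m"]) (use A PQ in auto)
    then have s1: "similar_mat A (four_block_mat (0\<^sub>m 1 1) r (0\<^sub>m m 1) A')"
      unfolding QAP similar_mat_def using similar_mat_wit_sym by blast
    from Suc.IH[OF A'] obtain a b N U V k where ab: "a + b = m"
      and N: "N \<in> carrier_mat a a" "N ^\<^sub>m k = 0\<^sub>m a a"
      and U: "U \<in> carrier_mat b b" "V \<in> carrier_mat b b" "U * V = 1\<^sub>m b" "V * U = 1\<^sub>m b"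
      and s2: "similar_mat A' (diag2 a b N U)"
      by blast
    from similar_mat_four_block_0_ex[OF similar_mat_refl[OF zero_carrier_mat] s2 r zero_carrier_mat A']
    obtain B0 where B0: "B0 \<in> carrier_mat 1 m"
      and s3: "similar_mat (four_block_mat (0\<^sub>m 1 1) r (0\<^sub>m m 1) A')
        (four_block_mat (0\<^sub>m 1 1) B0 (0\<^sub>m m 1) (diag2 a b N U))"
      by auto
    \<comment> \<open>Merging the kernel line with the nilpotent block moves the rest of the first row to C.\<close>
    define r1 where "r1 = mat 1 a (\<lambda>(i, j). B0 $$ (0, j))"
    define M where "M = four_block_mat (0\<^sub>m 1 1) r1 (0\<^sub>m a 1) N"
    define C where "C = mat (1 + a) b (\<lambda>(i, j). if i = 0 then B0 $$ (0, a + j) else 0)"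
    have M: "M \<in> carrier_mat (1 + a) (1 + a)" using four_block_carrier_mat[OF zero_carrier_mat N(1), of 1 1] by (simp add: M_def)
    have C: "C \<in> carrier_mat (1 + a) b" by (simp add: C_def)
    have regroup: "four_block_mat (0\<^sub>m 1 1) B0 (0\<^sub>m m 1) (diag2 a b N U) =
        four_block_mat M C (0\<^sub>m b (1 + a)) U" (is "?L = ?R")
      using B0 N U(1) ab
      by (intro eq_matI) (auto simp: M_def C_def r1_def not_less)
    \<comment> \<open>Only the first row of C is nonzero, and the first column of M vanishes.\<close>
    have MC: "M * C = 0\<^sub>m (1 + a) b"
    proof (rule eq_matI)
      fix i j assume "i < dim_row (0\<^sub>m (1 + a) b)" "j < dim_col (0\<^sub>m (1 + a) b)"
      then have ij: "i < 1 + a" "j < b" by auto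
      have "(M * C) $$ (i, j) = (\<Sum>l<1 + a. M $$ (i, l) * C $$ (l, j))"
        using M C ij by (auto simp: scalar_prod_def lessThan_atLeast0)
      also have "\<dots> = 0"
      proof (intro sum.neutral ballI)
        fix l assume "l \<in> {..<1 + a}"
        then show "M $$ (i, l) * C $$ (l, j) = 0"
          using ij N(1) by (cases "l = 0") (auto simp: M_def C_def r1_def)
      qed
      finally show "(M * C) $$ (i, j) = 0\<^sub>m (1 + a) b $$ (i, j)" using ij by simp
    qed (use M C in auto)
    define Z where "Z = C * V"
    have Z: "Z \<in> carrier_mat (1 + a) b" using C U by (auto simp: Z_def)
    have MZ: "M * Z = 0\<^sub>m (1 + a) b"
      using M C U MC unfolding Z_def by (subst assoc_mult_mat[symmetric, of _ "1 + a" "1 + a" _ b _ b]) auto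
    have ZU: "Z * U = C"
      using C U unfolding Z_def by (subst assoc_mult_mat[of _ "1 + a" b _ b _ b]) auto
    have s4: "similar_mat (four_block_mat M C (0\<^sub>m b (1 + a)) U) (diag2 (1 + a) b M U)"
      by (rule similar_block_upper_triangular[OF M U(1) Z MZ ZU])
    have "similar_mat A (diag2 (1 + a) b M U)"
      by (rule similar_mat_trans[OF s1 similar_mat_trans[OF s3[unfolded regroup] s4]])
    moreover have "\<exists>k. M ^\<^sub>m k = 0\<^sub>m (1 + a) (1 + a)"
      unfolding M_def
      by (rule nilpotent_block_upper_triangular[where p = 1]) (use N in \<open>auto simp: r1_def\<close>)
    ultimately show ?thesis using M U ab by (metis add_Suc plus_1_eq_Suc)
  qed
qed

section \<open>The second matrix is nilpotent and respects the splitting of the first\<close>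

definition diag_sum :: "'k::field mat \<Rightarrow> 'k" where "diag_sum A = (\<Sum>i<dim_row A. A $$ (i, i))"

lemma diag_sum_add:
  "A \<in> carrier_mat n n \<Longrightarrow> B \<in> carrier_mat n n \<Longrightarrow> diag_sum (A + B) = diag_sum A + diag_sum B"
  by (simp add: diag_sum_def sum.distrib)

lemma diag_sum_mult_comm:
  assumes "A \<in> carrier_mat n n" "B \<in> carrier_mat n n"
  shows "diag_sum (A * B) = diag_sum (B * A)"
proof -
  have "diag_sum (A * B) = (\<Sum>i<n. \<Sum>k<n. A $$ (i, k) * B $$ (k, i))"
    using assms by (simp add: diag_sum_def scalar_prod_def lessThan_atLeast0)
  also have "\<dots> = (\<Sum>k<n. \<Sum>i<n. B $$ (k, i) * A $$ (i, k))"
    by (subst sum.swap) (simp add: mult.commute)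
  also have "\<dots> = diag_sum (B * A)"
    using assms by (simp add: diag_sum_def scalar_prod_def lessThan_atLeast0)
  finally show ?thesis .
qed

text \<open>
  An invertible \<open>U\<close> would satisfy \<open>U\<^sup>-\<^sup>2 W U - U\<^sup>-\<^sup>1 W = 1\<close>. The two terms on the left have
  the same trace, so the size is zero in a field of characteristic zero.
\<close>

lemma jordan_pair_invertible_dim0:
  fixes U :: "'k::field_char_0 mat"
  assumes "jordan_pair b W U" "V \<in> carrier_mat b b" "U * V = 1\<^sub>m b" "V * U = 1\<^sub>m b"
  shows "b = 0"
proof -
  from assms have W: "W \<in> carrier_mat b b" and U: "U \<in> carrier_mat b b"
    and rel: "W * U = U * W + U * U" by (auto simp: jordan_pair_def)
  note V = assms(2)
  note assoc = mult_assoc_square[of _ b]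
  have VU: "V * (U * A) = A" if "A \<in> carrier_mat b b" for A
    using that U V assms(4) assoc[of V U A] by simp
  have UV: "U * (V * A) = A" if "A \<in> carrier_mat b b" for A
    using that U V assms(3) assoc[of U V A] by simp
  \<comment> \<open>Multiplying the relation by the square of the inverse V of U makes its last term the identity.\<close>
  have "V * (V * (W * U)) = V * (V * (U * W)) + V * (V * (U * U))"
    unfolding rel using U V W
    by (subst mult_add_distrib_mat[of _ b b _ b]; simp?)
      (subst mult_add_distrib_mat[of _ b b _ b]; simp?)
  also have "\<dots> = V * W + 1\<^sub>m b" using U V W VU assms(4) by simp
  finally have "diag_sum (V * (V * (W * U))) = diag_sum (V * W) + diag_sum (1\<^sub>m b :: 'k mat)"
    using V W by (simp add: diag_sum_add[of _ b])
  moreover have "diag_sum (V * (V * (W * U))) = diag_sum (V * W)"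
  proof -
    have "V * (V * (W * U)) = (V * (V * W)) * U" using U V W by (simp add: assoc)
    also have "diag_sum \<dots> = diag_sum (U * (V * (V * W)))"
      using U V W by (intro diag_sum_mult_comm[of _ b]) auto
    also have "U * (V * (V * W)) = V * W" using V W UV by simp
    finally show ?thesis .
  qed
  ultimately have "diag_sum (1\<^sub>m b :: 'k mat) = 0" by simp
  then show "b = 0" by (simp add: diag_sum_def)
qed

lemma jordan_pair_similar:
  assumes "jordan_pair n X Y" "similar_mat_wit X X' P Q" "similar_mat_wit Y Y' P Q"
  shows "jordan_pair n X' Y'"
proof -
  from assms have X: "X \<in> carrier_mat n n" and Y: "Y \<in> carrier_mat n n"
    and rel: "X * Y = Y * X + Y * Y" by (auto simp: jordan_pair_def)
  note x = similar_mat_witD2[OF X assms(2)] and y = similar_mat_witD2[OF Y assms(3)]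
  note c = \<open>P \<in> carrier_mat n n\<close> \<open>Q \<in> carrier_mat n n\<close>
  have X': "X' = Q * X * P" and Y': "Y' = Q * Y * P"
    using similar_mat_witD2(3)[OF _ similar_mat_wit_sym[OF assms(2)], of n n]
      similar_mat_witD2(3)[OF _ similar_mat_wit_sym[OF assms(3)], of n n] x y by auto
  have conj_mult: "(Q * A * P) * (Q * B * P) = Q * (A * B) * P"
    if "A \<in> carrier_mat n n" "B \<in> carrier_mat n n" for A B
  proof -
    have "(Q * A * P) * (Q * B * P) = Q * A * ((P * Q) * (B * P))"
      using that c by (simp add: mult_assoc_square[of _ n])
    then show ?thesis using that c x(1) by (simp add: mult_assoc_square[of _ n])
  qed
  have "X' * Y' = Q * (Y * X + Y * Y) * P"
    unfolding X' Y' using conj_mult[OF X Y] rel by simp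
  also have "\<dots> = Q * (Y * X) * P + Q * (Y * Y) * P"
    using c X Y by (simp add: mult_add_distrib_mat[of _ n n _ n] add_mult_distrib_mat[of _ n n _ _ n])
  also have "\<dots> = Y' * X' + Y' * Y'" unfolding X' Y' using conj_mult X Y by simp
  finally show ?thesis using x y by (auto simp: jordan_pair_def)
qed

text \<open>
  In the Fitting decomposition of \<open>Y\<close> the relation is inherited by the lower right diagonal
  block, where \<open>Y\<close> is invertible. So that block is empty.
\<close>

lemma jordan_pair_nilpotent:
  fixes X :: "'k::field_char_0 mat"
  assumes pair: "jordan_pair n X Y"
  shows "\<exists>k. Y ^\<^sub>m k = 0\<^sub>m n n"
proof -
  from pair have X: "X \<in> carrier_mat n n" and Y: "Y \<in> carrier_mat n n"
    by (auto simp: jordan_pair_def)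
  from fitting_decomposition[OF Y] obtain a b M U V k P Q
    where ab: "a + b = n" and M: "M \<in> carrier_mat a a" "M ^\<^sub>m k = 0\<^sub>m a a"
      and U: "U \<in> carrier_mat b b" and V: "V \<in> carrier_mat b b" "U * V = 1\<^sub>m b" "V * U = 1\<^sub>m b"
      and s: "similar_mat_wit Y (diag2 a b M U) P Q"
    unfolding similar_mat_def by blast
  note y = similar_mat_witD2[OF Y s]
  have sX: "similar_mat_wit (Q * X * P) X Q P"
    by (rule similar_mat_witI[of _ _ n]) (use X y in auto)
  note pair' = jordan_pair_similar[OF pair similar_mat_wit_sym[OF sX] s]
  have "Q * X * P \<in> carrier_mat (a + b) (a + b)" using X y ab by simp
  then obtain X11 X12 X21 X22 where bl: "Q * X * P = four_block_mat X11 X12 X21 X22"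
    "X11 \<in> carrier_mat a a" "X12 \<in> carrier_mat a b" "X21 \<in> carrier_mat b a" "X22 \<in> carrier_mat b b"
    by (rule four_block_mat_cases)
  from pair' have "four_block_mat X11 X12 X21 X22 * diag2 a b M U =
      diag2 a b M U * four_block_mat X11 X12 X21 X22 + diag2 a b M U * diag2 a b M U"
    by (simp add: jordan_pair_def bl(1))
  then have "four_block_mat (X11 * M) (X12 * U) (X21 * M) (X22 * U) =
      four_block_mat (M * X11 + M * M) (M * X12) (U * X21) (U * X22 + U * U)"
    using bl M U
    by (simp add: mult_four_block_mat[of _ a a _ b _ b _ _ a _ b] add_four_block_mat[of _ a a _ b _ b])
  then have "X22 * U = U * X22 + U * U"
    by (rule four_block_mat_inject[of _ _ _ _ _ _ _ _ a a b b, THEN conjunct2, THEN conjunct2, THEN conjunct2])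
      (use bl M U in auto)
  then have "jordan_pair b X22 U" using bl U by (simp add: jordan_pair_def)
  then have "b = 0" by (rule jordan_pair_invertible_dim0[OF _ V])
  then have "diag2 a b M U ^\<^sub>m k = 0\<^sub>m n n"
    using M U ab by (subst pow_four_block_mat) (auto intro!: eq_matI)
  then have "Y ^\<^sub>m k = P * 0\<^sub>m n n * Q" using similar_mat_wit_pow_id[OF s, of k] by simp
  then have "Y ^\<^sub>m k = 0\<^sub>m n n" using y by simp
  then show ?thesis by blast
qed

text \<open>
  Iterating \<open>W = M W V\<close> produces a power of \<open>M\<close>, which eventually is zero.
\<close>

lemma sylvester_nilpotent_invertible:
  assumes "M \<in> carrier_mat a a" "M ^\<^sub>m k = 0\<^sub>m a a" "U \<in> carrier_mat b b" "V \<in> carrier_mat b b"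
    "U * V = 1\<^sub>m b" "W \<in> carrier_mat a b" "M * W = W * U"
  shows "W = 0\<^sub>m a b"
proof -
  have 1: "M * W * V = W"
    using assms by (simp add: assoc_mult_mat[of _ a b _ b _ b])
  have "W = M ^\<^sub>m l * W * V ^\<^sub>m l" for l
  proof (induction l)
    case (Suc l)
    have "M ^\<^sub>m Suc l * W * V ^\<^sub>m Suc l = M ^\<^sub>m l * (M * W * V) * V ^\<^sub>m l"
      using assms(1,4,6) pow_mat_Suc_left[OF assms(4), of l]
      by (simp add: assoc_mult_mat[of _ a a _ a _ b] assoc_mult_mat[of _ a a _ b _ b]
          assoc_mult_mat[of _ a b _ b _ b])
    then show ?case using Suc 1 by simp
  qed (use assms in simp)
  from this[of k] show ?thesis using assms by simp
qed

lemma sylvester_invertible_nilpotent: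
  assumes "M \<in> carrier_mat a a" "M ^\<^sub>m k = 0\<^sub>m a a" "U \<in> carrier_mat b b" "V \<in> carrier_mat b b"
    "V * U = 1\<^sub>m b" "W \<in> carrier_mat b a" "U * W = W * M"
  shows "W = 0\<^sub>m b a"
proof -
  have 1: "V * (W * M) = W"
    using assms(1-6) by (simp flip: assms(7) add: assoc_mult_mat[symmetric, of _ b b _ b _ a])
  have "W = V ^\<^sub>m l * W * M ^\<^sub>m l" for l
  proof (induction l)
    case (Suc l)
    have "V ^\<^sub>m Suc l * W * M ^\<^sub>m Suc l = V ^\<^sub>m l * (V * (W * M)) * M ^\<^sub>m l"
      using assms(1,4,6) pow_mat_Suc_left[OF assms(1), of l]
      by (simp add: assoc_mult_mat[of _ b b _ b _ a] assoc_mult_mat[of _ b b _ a _ a]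
          assoc_mult_mat[of _ b a _ a _ a])
    then show ?case using Suc 1 by simp
  qed (use assms in simp)
  from this[of k] show ?thesis using assms by simp
qed

text \<open>
  Since \<open>ad D\<close> maps \<open>Z\<^sup>i\<close> to \<open>i Z\<^sup>i\<^sup>+\<^sup>1\<close> and \<open>Z\<close> is nilpotent, \<open>ad D\<close> is nilpotent on the powers of
  \<open>Z\<close>. On off-diagonal blocks, however, \<open>ad D\<close> is injective, because \<open>M\<close> is nilpotent and \<open>U\<close> is
  invertible. Hence these blocks vanish.
\<close>

lemma jordan_pair_block_diagonal:
  fixes M :: "'k::field_char_0 mat"
  assumes pair: "jordan_pair (a + b) (diag2 a b M U) Z"
    and M: "M \<in> carrier_mat a a" "M ^\<^sub>m k = 0\<^sub>m a a"
    and U: "U \<in> carrier_mat b b" "V \<in> carrier_mat b b" "U * V = 1\<^sub>m b" "V * U = 1\<^sub>m b"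
  obtains Z1 Z2 where "Z = diag2 a b Z1 Z2" "jordan_pair a M Z1" "jordan_pair b U Z2"
proof -
  let ?D = "diag2 a b M U"
  from pair have Z: "Z \<in> carrier_mat (a + b) (a + b)" by (auto simp: jordan_pair_def)
  from jordan_pair_nilpotent[OF pair] obtain q where q: "Z ^\<^sub>m q = 0\<^sub>m (a + b) (a + b)" by blast
  \<comment> \<open>The off-diagonal blocks of Z^(i+1) vanish by assumption, so those of Z^i solve homogeneous Sylvester equations.\<close>
  have step: "\<exists>A\<in>carrier_mat a a. \<exists>B\<in>carrier_mat b b. Z ^\<^sub>m i = diag2 a b A B"
    if "A' \<in> carrier_mat a a" "B' \<in> carrier_mat b b" "Z ^\<^sub>m Suc i = diag2 a b A' B'" for i A' B'
  proof -
    have "Z ^\<^sub>m i \<in> carrier_mat (a + b) (a + b)" using Z by simp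
    then obtain W11 W12 W21 W22 where bl: "Z ^\<^sub>m i = four_block_mat W11 W12 W21 W22"
      "W11 \<in> carrier_mat a a" "W12 \<in> carrier_mat a b" "W21 \<in> carrier_mat b a" "W22 \<in> carrier_mat b b"
      by (rule four_block_mat_cases)
    have "?D * four_block_mat W11 W12 W21 W22 =
        four_block_mat W11 W12 W21 W22 * ?D + of_nat i \<cdot>\<^sub>m diag2 a b A' B'"
      using jordan_pair_mult_pow[OF pair, of i] unfolding bl(1) that(3) .
    then have eq: "four_block_mat (M * W11) (M * W12) (U * W21) (U * W22) =
        four_block_mat (W11 * M + of_nat i \<cdot>\<^sub>m A') (W12 * U) (W21 * M) (W22 * U + of_nat i \<cdot>\<^sub>m B')"
      using bl M U that(1,2)
      by (simp add: mult_four_block_mat[of _ a a _ b _ b _ _ a _ b]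
          add_four_block_mat[of _ a a _ b _ b] smult_four_block_mat[of _ a a _ b _ b])
    have "M * W12 = W12 * U \<and> U * W21 = W21 * M"
      using four_block_mat_inject[OF eq, of a a b b] bl M U that(1,2) by auto
    then have "W12 = 0\<^sub>m a b" "W21 = 0\<^sub>m b a"
      using sylvester_nilpotent_invertible[OF M U(1,2,3) bl(3)]
        sylvester_invertible_nilpotent[OF M U(1,2,4) bl(4)] by auto
    with bl show ?thesis by auto
  qed
  \<comment> \<open>Induction downwards along the powers of Z, from the vanishing power Z^q to Z itself.\<close>
  have "\<exists>A\<in>carrier_mat a a. \<exists>B\<in>carrier_mat b b. Z ^\<^sub>m (q - j) = diag2 a b A B" for j
  proof (induction j)
    case 0
    show ?case using q
      by (intro bexI[of _ "0\<^sub>m a a"] bexI[of _ "0\<^sub>m b b"]) auto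
  next
    case (Suc j)
    show ?case
    proof (cases "j < q")
      case True
      then have "q - j = Suc (q - Suc j)" by simp
      with Suc step show ?thesis by metis
    next
      case False
      with Suc show ?thesis by simp
    qed
  qed
  from this[of "q - 1"] have "\<exists>A\<in>carrier_mat a a. \<exists>B\<in>carrier_mat b b. Z ^\<^sub>m 1 = diag2 a b A B"
  proof (cases "q = 0")
    case True
    then have "Z ^\<^sub>m 1 = 0\<^sub>m (a + b) (a + b)" using q Z pow_mat_eq_zero_mono[OF Z q, of 1] by simp
    then show ?thesis
      by (intro bexI[of _ "0\<^sub>m a a"] bexI[of _ "0\<^sub>m b b"]) auto
  qed (simp add: Suc_leI)
  then obtain Z1 Z2 where Z12: "Z1 \<in> carrier_mat a a" "Z2 \<in> carrier_mat b b" "Z = diag2 a b Z1 Z2"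
    using Z by auto
  from pair have "?D * diag2 a b Z1 Z2 = diag2 a b Z1 Z2 * ?D + diag2 a b Z1 Z2 * diag2 a b Z1 Z2"
    by (simp add: jordan_pair_def Z12(3))
  then have eq: "diag2 a b (M * Z1) (U * Z2) = diag2 a b (Z1 * M + Z1 * Z1) (Z2 * U + Z2 * Z2)"
    using Z12(1,2) M U
    by (simp add: mult_four_block_mat[of _ a a _ b _ b _ _ a _ b] add_four_block_mat[of _ a a _ b _ b])
  have "M * Z1 = Z1 * M + Z1 * Z1 \<and> U * Z2 = Z2 * U + Z2 * Z2"
    using four_block_mat_inject[OF eq, of a a b b] Z12(1,2) M U by auto
  then show ?thesis using Z12 M U by (intro that) (auto simp: jordan_pair_def)
qed

section \<open>The upper bound for arbitrary pairs\<close>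

lemma gen_alg_similar:
  assumes X: "X \<in> carrier_mat n n" and Y: "Y \<in> carrier_mat n n"
    and sX: "similar_mat_wit X X' P Q" and sY: "similar_mat_wit Y Y' P Q"
    and a: "a \<in> gen_alg n X Y"
  shows "\<exists>a'\<in>gen_alg n X' Y'. a = P * a' * Q"
  using a
proof (induction rule: gen_alg.induct)
  note x = similar_mat_witD2[OF X sX] and y = similar_mat_witD2[OF Y sY]
  note carr = gen_alg_carrier[OF _ x(5) y(5)]
  {
    case one
    show ?case using x by (intro bexI[of _ "1\<^sub>m n"] gen_alg.one) auto
  next
    case (add a b)
    then obtain a' b' where "a' \<in> gen_alg n X' Y'" "b' \<in> gen_alg n X' Y'"
      "a = P * a' * Q" "b = P * b' * Q" by blast
    moreover from this have "P * (a' + b') * Q = P * a' * Q + P * b' * Q"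
      using carr x by (simp add: mult_add_distrib_mat[of _ n n _ n] add_mult_distrib_mat[of _ n n _ _ n])
    ultimately show ?case by (intro bexI[of _ "a' + b'"] gen_alg.add) auto
  next
    case (smult a c)
    then obtain a' where "a' \<in> gen_alg n X' Y'" "a = P * a' * Q" by blast
    moreover from this have "P * (c \<cdot>\<^sub>m a') * Q = c \<cdot>\<^sub>m (P * a' * Q)"
      using carr x by (simp add: mult_smult_distrib[of _ n n _ n] mult_smult_assoc_mat[of _ n n _ n])
    ultimately show ?case by (intro bexI[of _ "c \<cdot>\<^sub>m a'"] gen_alg.smult) auto
  next
    case (multX a)
    then obtain a' where a': "a' \<in> gen_alg n X' Y'" "a = P * a' * Q" by blast
    note c = carr[OF a'(1)]
    have "X * a = P * X' * ((Q * P) * (a' * Q))"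
      unfolding x(3) a'(2) using c x(5-7) by (simp add: mult_assoc_square[of _ n])
    also have "(Q * P) * (a' * Q) = a' * Q"
      using c x by simp
    also have "P * X' * (a' * Q) = P * (X' * a') * Q"
      using c x by (simp add: mult_assoc_square[of _ n])
    finally show ?case using a' by (intro bexI[of _ "X' * a'"] gen_alg.multX) auto
  next
    case (multY a)
    then obtain a' where a': "a' \<in> gen_alg n X' Y'" "a = P * a' * Q" by blast
    note c = carr[OF a'(1)]
    have "Y * a = P * Y' * ((Q * P) * (a' * Q))"
      unfolding y(3) a'(2) using c y(5-7) by (simp add: mult_assoc_square[of _ n])
    also have "(Q * P) * (a' * Q) = a' * Q"
      using c x by simp
    also have "P * Y' * (a' * Q) = P * (Y' * a') * Q"
      using c y by (simp add: mult_assoc_square[of _ n])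
    finally show ?case using a' by (intro bexI[of _ "Y' * a'"] gen_alg.multY) auto
  }
qed

lemma alg_bound_similar:
  assumes X: "X \<in> carrier_mat n n" and Y: "Y \<in> carrier_mat n n"
    and sX: "similar_mat_wit X X' P Q" and sY: "similar_mat_wit Y Y' P Q"
    and bound: "alg_bound n X' Y' c"
  shows "alg_bound n X Y c"
proof -
  note x = similar_mat_witD2[OF X sX]
  from bound obtain B where B: "finite B" "B \<subseteq> carrier_mat n n" "card B \<le> c"
    "gen_alg n X' Y' \<subseteq> mat_span n B" by (auto simp: alg_bound_def)
  let ?f = "\<lambda>a. P * a * Q"
  have "gen_alg n X Y \<subseteq> mat_span n (?f ` B)"
  proof
    fix a assume "a \<in> gen_alg n X Y"
    then obtain a' where "a' \<in> gen_alg n X' Y'" "a = ?f a'"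
      using gen_alg_similar[OF X Y sX sY] by blast
    moreover have "?f a' \<in> mat_span n (?f ` B)" if "a' \<in> mat_span n B" for a'
      by (rule mat_span_linear_image[OF that B(2)])
        (use x in \<open>auto simp: mult_add_distrib_mat[of _ n n _ n] add_mult_distrib_mat[of _ n n _ _ n]
          mult_smult_distrib[of _ n n _ n] mult_smult_assoc_mat[of _ n n _ n] intro: mat_span.gen\<close>)
    ultimately show "a \<in> mat_span n (?f ` B)" using B(4) by blast
  qed
  moreover have "?f ` B \<subseteq> carrier_mat n n" using B(2) x by auto
  ultimately show ?thesis
    unfolding alg_bound_def using B card_image_le[OF B(1), of ?f] by (intro exI[of _ "?f ` B"]) auto
qed

lemma gen_alg_block_diagonal:
  assumes "X1 \<in> carrier_mat a a" "Y1 \<in> carrier_mat a a" "X2 \<in> carrier_mat b b" "Y2 \<in> carrier_mat b b"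
    "m \<in> gen_alg (a + b) (diag2 a b X1 X2) (diag2 a b Y1 Y2)"
  shows "\<exists>u\<in>gen_alg a X1 Y1. \<exists>v\<in>gen_alg b X2 Y2. m = diag2 a b u v"
  using assms(5)
proof (induction rule: gen_alg.induct)
  note carr = gen_alg_carrier[OF _ assms(1,2)] gen_alg_carrier[OF _ assms(3,4)]
  note mult = mult_four_block_mat[of _ a a _ b _ b _ _ a _ b]
  {
    case one
    show ?case by (intro bexI[of _ "1\<^sub>m a"] bexI[of _ "1\<^sub>m b"] gen_alg.one) auto
  next
    case (add p q)
    then obtain u v u' v' where "u \<in> gen_alg a X1 Y1" "v \<in> gen_alg b X2 Y2" "p = diag2 a b u v"
      "u' \<in> gen_alg a X1 Y1" "v' \<in> gen_alg b X2 Y2" "q = diag2 a b u' v'" by blast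
    then show ?case using carr
      by (intro bexI[of _ "u + u'"] bexI[of _ "v + v'"] gen_alg.add)
        (auto simp: add_four_block_mat[of _ a a _ b _ b])
  next
    case (smult p c)
    then obtain u v where "u \<in> gen_alg a X1 Y1" "v \<in> gen_alg b X2 Y2" "p = diag2 a b u v" by blast
    then show ?case using carr
      by (intro bexI[of _ "c \<cdot>\<^sub>m u"] bexI[of _ "c \<cdot>\<^sub>m v"] gen_alg.smult)
        (auto simp: smult_four_block_mat[of _ a a _ b _ b])
  next
    case (multX p)
    then obtain u v where "u \<in> gen_alg a X1 Y1" "v \<in> gen_alg b X2 Y2" "p = diag2 a b u v" by blast
    moreover from this have "u \<in> carrier_mat a a" "v \<in> carrier_mat b b" using carr by auto
    with \<open>p = _\<close> have "diag2 a b X1 X2 * p = diag2 a b (X1 * u) (X2 * v)"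
      using assms(1-4) by (simp add: mult)
    ultimately show ?case by (blast intro: gen_alg.multX)
  next
    case (multY p)
    then obtain u v where "u \<in> gen_alg a X1 Y1" "v \<in> gen_alg b X2 Y2" "p = diag2 a b u v" by blast
    moreover from this have "u \<in> carrier_mat a a" "v \<in> carrier_mat b b" using carr by auto
    with \<open>p = _\<close> have "diag2 a b Y1 Y2 * p = diag2 a b (Y1 * u) (Y2 * v)"
      using assms(1-4) by (simp add: mult)
    ultimately show ?case by (blast intro: gen_alg.multY)
  }
qed

lemma alg_bound_block_diagonal:
  assumes X1: "X1 \<in> carrier_mat a a" and Y1: "Y1 \<in> carrier_mat a a"
    and X2: "X2 \<in> carrier_mat b b" and Y2: "Y2 \<in> carrier_mat b b"
    and "alg_bound a X1 Y1 c" "alg_bound b X2 Y2 d"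
  shows "alg_bound (a + b) (diag2 a b X1 X2) (diag2 a b Y1 Y2) (c + d)"
proof -
  from assms(5) obtain B where B: "finite B" "B \<subseteq> carrier_mat a a" "card B \<le> c"
    "gen_alg a X1 Y1 \<subseteq> mat_span a B" by (auto simp: alg_bound_def)
  from assms(6) obtain C where C: "finite C" "C \<subseteq> carrier_mat b b" "card C \<le> d"
    "gen_alg b X2 Y2 \<subseteq> mat_span b C" by (auto simp: alg_bound_def)
  let ?f = "\<lambda>u. diag2 a b u (0\<^sub>m b b)" and ?g = "\<lambda>v. diag2 a b (0\<^sub>m a a) v"
  let ?S = "?f ` B \<union> ?g ` C"
  have "gen_alg (a + b) (diag2 a b X1 X2) (diag2 a b Y1 Y2) \<subseteq> mat_span (a + b) ?S"
  proof
    fix m assume "m \<in> gen_alg (a + b) (diag2 a b X1 X2) (diag2 a b Y1 Y2)"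
    then obtain u v where u: "u \<in> gen_alg a X1 Y1" and v: "v \<in> gen_alg b X2 Y2"
      and m: "m = diag2 a b u v"
      using gen_alg_block_diagonal[OF X1 Y1 X2 Y2] by blast
    have "?f u \<in> mat_span (a + b) ?S"
      by (rule mat_span_linear_image[of u a B])
        (use u B in \<open>auto simp: add_four_block_mat[of _ a a _ b _ b] smult_four_block_mat[of _ a a _ b _ b]
          intro: mat_span.gen\<close>)
    moreover have "?g v \<in> mat_span (a + b) ?S"
      by (rule mat_span_linear_image[of v b C])
        (use v C in \<open>auto simp: add_four_block_mat[of _ a a _ b _ b] smult_four_block_mat[of _ a a _ b _ b]
          intro: mat_span.gen\<close>)
    moreover have "m = ?f u + ?g v"
      unfolding m using gen_alg_carrier[OF u X1 Y1] gen_alg_carrier[OF v X2 Y2]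
      by (simp add: add_four_block_mat[of _ a a _ b _ b])
    ultimately show "m \<in> mat_span (a + b) ?S" by (simp add: mat_span.add)
  qed
  moreover have "card ?S \<le> c + d"
    using card_Un_le[of "?f ` B" "?g ` C"] card_image_le[OF B(1), of ?f] card_image_le[OF C(1), of ?g]
      B(3) C(3) by linarith
  moreover have "?S \<subseteq> carrier_mat (a + b) (a + b)"
    using B(2) C(2) by auto
  ultimately show ?thesis unfolding alg_bound_def using B(1) C(1) by (intro exI[of _ ?S]) auto
qed

lemma alg_bound_mono: "alg_bound n X Y c \<Longrightarrow> c \<le> d \<Longrightarrow> alg_bound n X Y d"
  unfolding alg_bound_def by (meson le_trans)

lemma jordan_pair_shift:
  assumes "jordan_pair n X Y"
  shows "jordan_pair n (X + c \<cdot>\<^sub>m 1\<^sub>m n) Y"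
proof -
  from assms have X: "X \<in> carrier_mat n n" and Y: "Y \<in> carrier_mat n n"
    and rel: "X * Y = Y * X + Y * Y" by (auto simp: jordan_pair_def)
  have "(X + c \<cdot>\<^sub>m 1\<^sub>m n) * Y = X * Y + c \<cdot>\<^sub>m Y"
    using X Y by (simp add: add_mult_distrib_mat[of _ n n _ _ n] mult_smult_assoc_mat[of _ n n _ n])
  moreover have "Y * (X + c \<cdot>\<^sub>m 1\<^sub>m n) = Y * X + c \<cdot>\<^sub>m Y"
    using X Y by (simp add: mult_add_distrib_mat[of _ n n _ n] mult_smult_distrib[of _ n n _ n])
  moreover have "Y * X + Y * Y + c \<cdot>\<^sub>m Y = Y * X + c \<cdot>\<^sub>m Y + Y * Y"
    using X Y by (intro eq_matI) (auto simp: algebra_simps simp del: index_mult_mat(1))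
  ultimately show ?thesis using X Y rel by (simp add: jordan_pair_def)
qed

text \<open>
  Subtracting a scalar from \<open>X\<close> does not change the generated algebra. So an eigenvalue of \<open>X\<close>
  may be moved to zero.
\<close>

lemma alg_bound_shift:
  assumes X: "X \<in> carrier_mat n n" and Y: "Y \<in> carrier_mat n n"
    and "alg_bound n (X + c \<cdot>\<^sub>m 1\<^sub>m n) Y d"
  shows "alg_bound n X Y d"
proof -
  let ?X = "X + c \<cdot>\<^sub>m 1\<^sub>m n"
  have "a \<in> gen_alg n ?X Y" if "a \<in> gen_alg n X Y" for a
    using that
  proof (induction rule: gen_alg.induct)
    case (multX a)
    have a: "a \<in> carrier_mat n n" using gen_alg_carrier[OF multX(1) X Y] .
    have "?X * a = X * a + c \<cdot>\<^sub>m a"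
      using X a by (simp add: add_mult_distrib_mat[of _ n n _ _ n] mult_smult_assoc_mat[of _ n n _ n])
    then have "X * a = ?X * a + (- c) \<cdot>\<^sub>m a"
      using X a by (auto intro!: eq_matI simp del: index_mult_mat(1))
    with multX show ?case by (auto intro: gen_alg.intros)
  qed (auto intro: gen_alg.intros)
  with assms(3) show ?thesis unfolding alg_bound_def by (meson subset_iff)
qed

text \<open>
  Take \<open>Y\<^sup>i\<close> with \<open>i\<close> maximal such that it is nonzero, then \<open>Y\<^sup>i X\<^sup>j\<close> with \<open>j\<close> maximal such that
  it is nonzero. Left multiplication by \<open>Y\<close> or \<open>X\<close> kills this matrix, so each of its columns is
  in both kernels.
\<close>

lemma jordan_pair_common_kernel:
  fixes X :: "'k::field mat"
  assumes pair: "jordan_pair n X Y" and n: "n > 0"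
    and "X ^\<^sub>m p = 0\<^sub>m n n" "Y ^\<^sub>m q = 0\<^sub>m n n"
  obtains v where "v \<in> carrier_vec n" "v \<noteq> 0\<^sub>v n" "X *\<^sub>v v = 0\<^sub>v n" "Y *\<^sub>v v = 0\<^sub>v n"
proof -
  from pair have X: "X \<in> carrier_mat n n" and Y: "Y \<in> carrier_mat n n"
    by (auto simp: jordan_pair_def)
  have one: "1\<^sub>m n \<noteq> (0\<^sub>m n n :: 'k mat)"
  proof
    assume "1\<^sub>m n = (0\<^sub>m n n :: 'k mat)"
    from arg_cong[OF this, of "\<lambda>A. A $$ (0, 0)"] n show False by simp
  qed
  have "\<exists>i. Y ^\<^sub>m i \<noteq> 0\<^sub>m n n \<and> Y ^\<^sub>m Suc i = 0\<^sub>m n n"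
  proof -
    let ?q = "LEAST q. Y ^\<^sub>m q = 0\<^sub>m n n"
    have q: "Y ^\<^sub>m ?q = 0\<^sub>m n n" by (rule LeastI[of _ q]) fact
    then have "?q \<noteq> 0" using one Y by (metis carrier_matD(1) pow_mat.simps(1))
    then obtain i where i: "?q = Suc i" by (metis not0_implies_Suc)
    have "Y ^\<^sub>m i \<noteq> 0\<^sub>m n n" using i not_less_Least[of i "\<lambda>q. Y ^\<^sub>m q = 0\<^sub>m n n"] by auto
    with q i show ?thesis by auto
  qed
  then obtain i where i: "Y ^\<^sub>m i \<noteq> 0\<^sub>m n n" "Y ^\<^sub>m Suc i = 0\<^sub>m n n" by blast
  have "\<exists>j. Y ^\<^sub>m i * X ^\<^sub>m j \<noteq> 0\<^sub>m n n \<and> Y ^\<^sub>m i * X ^\<^sub>m Suc j = 0\<^sub>m n n"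
  proof -
    let ?p = "LEAST p. Y ^\<^sub>m i * X ^\<^sub>m p = 0\<^sub>m n n"
    have p: "Y ^\<^sub>m i * X ^\<^sub>m ?p = 0\<^sub>m n n"
      by (rule LeastI[of _ p]) (use assms(3) Y in simp)
    then have "?p \<noteq> 0" using i(1) X Y
      by (metis carrier_matD(1) pow_carrier_mat pow_mat.simps(1) right_mult_one_mat)
    then obtain j where j: "?p = Suc j" by (metis not0_implies_Suc)
    have "Y ^\<^sub>m i * X ^\<^sub>m j \<noteq> 0\<^sub>m n n" using j not_less_Least[of j "\<lambda>p. Y ^\<^sub>m i * X ^\<^sub>m p = 0\<^sub>m n n"] by auto
    with p j show ?thesis by auto
  qed
  then obtain j where j: "Y ^\<^sub>m i * X ^\<^sub>m j \<noteq> 0\<^sub>m n n" "Y ^\<^sub>m i * X ^\<^sub>m Suc j = 0\<^sub>m n n" by blast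
  \<comment> \<open>By maximality of i and j, both X and Y annihilate every column of W.\<close>
  define W where "W = Y ^\<^sub>m i * X ^\<^sub>m j"
  have W: "W \<in> carrier_mat n n" using X Y by (simp add: W_def)
  have XW: "X * W = 0\<^sub>m n n"
    unfolding W_def jordan_pair_mult_monomial[OF pair] i(2) j(2) using X by simp
  have "Y * W = Y ^\<^sub>m Suc i * X ^\<^sub>m j"
    using X Y pow_mat_Suc_left[OF Y, of i] unfolding W_def by (simp add: mult_assoc_square[of _ n])
  then have YW: "Y * W = 0\<^sub>m n n" unfolding i(2) using X by simp
  have "\<exists>r c. r < n \<and> c < n \<and> W $$ (r, c) \<noteq> 0"
    using j(1) W unfolding W_def[symmetric] by (metis carrier_matD eq_matI index_zero_mat)
  then obtain r c where rc: "r < n" "c < n" "W $$ (r, c) \<noteq> 0" by blast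
  have "col W c $ r \<noteq> 0" using rc W by simp
  then have "col W c \<noteq> 0\<^sub>v n" using rc by auto
  moreover have "X *\<^sub>v col W c = 0\<^sub>v n" "Y *\<^sub>v col W c = 0\<^sub>v n"
    using col_mult2[OF X W rc(2)] col_mult2[OF Y W rc(2)] rc XW YW by auto
  moreover have "col W c \<in> carrier_vec n" using W rc by (auto intro: col_carrier_vec)
  ultimately show ?thesis by (intro that)
qed

text \<open>
  A common kernel vector becomes the first basis vector, and the relation and nilpotency pass to
  the lower right block.
\<close>

lemma jordan_pair_strictly_triangularizable:
  fixes X :: "'k::field mat"
  assumes "jordan_pair n X Y" "X ^\<^sub>m p = 0\<^sub>m n n" "Y ^\<^sub>m q = 0\<^sub>m n n"
  shows "\<exists>X' Y' P Q. similar_mat_wit X X' P Q \<and> similar_mat_wit Y Y' P Q \<and> band n 1 X' \<and> band n 1 Y'"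
  using assms
proof (induction n arbitrary: X Y)
  case 0
  then have "X \<in> carrier_mat 0 0" "Y \<in> carrier_mat 0 0" by (auto simp: jordan_pair_def)
  then show ?case
    using similar_mat_wit_refl[of X 0] similar_mat_wit_refl[of Y 0] by (auto simp: band_def)
next
  case (Suc m)
  from Suc.prems have X: "X \<in> carrier_mat (Suc m) (Suc m)" and Y: "Y \<in> carrier_mat (Suc m) (Suc m)"
    by (auto simp: jordan_pair_def)
  obtain v where v: "v \<in> carrier_vec (Suc m)" "v \<noteq> 0\<^sub>v (Suc m)"
    "X *\<^sub>v v = 0\<^sub>v (Suc m)" "Y *\<^sub>v v = 0\<^sub>v (Suc m)"
    by (rule jordan_pair_common_kernel[OF Suc.prems(1) _ Suc.prems(2,3)]) auto
  obtain P Q where PQ: "P \<in> carrier_mat (Suc m) (Suc m)" "Q \<in> carrier_mat (Suc m) (Suc m)"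
    "P * Q = 1\<^sub>m (Suc m)" "Q * P = 1\<^sub>m (Suc m)" "col P 0 = v"
    by (rule exists_invertible_first_col[OF v(1,2)])
  obtain r X' where r: "r \<in> carrier_mat 1 m" and X': "X' \<in> carrier_mat m m"
    and QXP: "Q * X * P = four_block_mat (0\<^sub>m 1 1) r (0\<^sub>m m 1) X'"
    by (rule kernel_vector_conj_block[OF X PQ(1,2,4)]) (use v PQ in auto)
  obtain s Y' where s: "s \<in> carrier_mat 1 m" and Y': "Y' \<in> carrier_mat m m"
    and QYP: "Q * Y * P = four_block_mat (0\<^sub>m 1 1) s (0\<^sub>m m 1) Y'"
    by (rule kernel_vector_conj_block[OF Y PQ(1,2,4)]) (use v PQ in auto)
  let ?X = "four_block_mat (0\<^sub>m 1 1) r (0\<^sub>m m 1) X'" and ?Y = "four_block_mat (0\<^sub>m 1 1) s (0\<^sub>m m 1) Y'"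
  have "similar_mat_wit (Q * X * P) X Q P" "similar_mat_wit (Q * Y * P) Y Q P"
    by (rule similar_mat_witI[of _ _ "Suc m"]; use X Y PQ in simp)+
  then have sX: "similar_mat_wit X ?X P Q" and sY: "similar_mat_wit Y ?Y P Q"
    unfolding QXP QYP by (auto intro: similar_mat_wit_sym)
  have pair: "jordan_pair (Suc m) ?X ?Y" by (rule jordan_pair_similar[OF Suc.prems(1) sX sY])
  then have "?X * ?Y = ?Y * ?X + ?Y * ?Y" by (simp add: jordan_pair_def)
  then have eq: "four_block_mat (0\<^sub>m 1 1) (r * Y') (0\<^sub>m m 1) (X' * Y') =
      four_block_mat (0\<^sub>m 1 1) (s * X' + s * Y') (0\<^sub>m m 1) (Y' * X' + Y' * Y')"
    using r s X' Y'
    by (simp add: mult_four_block_mat[of _ 1 1 _ m _ m _ _ 1 _ m, unfolded One_nat_def]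
        add_four_block_mat[of _ 1 1 _ m _ m, unfolded One_nat_def])
  have "X' * Y' = Y' * X' + Y' * Y'"
    using four_block_mat_inject[OF eq, of 1 1 m m] r s X' Y' by auto
  then have pair': "jordan_pair m X' Y'" using X' Y' by (simp add: jordan_pair_def)
  have nil: "A' ^\<^sub>m k = 0\<^sub>m m m" if sA: "similar_mat_wit A (four_block_mat (0\<^sub>m 1 1) t (0\<^sub>m m 1) A') P Q"
    and Ak: "A ^\<^sub>m k = 0\<^sub>m (Suc m) (Suc m)" and t: "t \<in> carrier_mat 1 m" and A': "A' \<in> carrier_mat m m" for A A' t k
  proof -
    have "four_block_mat (0\<^sub>m 1 1) t (0\<^sub>m m 1) A' ^\<^sub>m k = Q * A ^\<^sub>m k * P"
      by (rule similar_mat_wit_pow_id[OF similar_mat_wit_sym[OF sA]])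
    also have "\<dots> = 0\<^sub>m (1 + m) (1 + m)" using Ak PQ by simp
    also have "\<dots> = four_block_mat (0\<^sub>m 1 1) (0\<^sub>m 1 m) (0\<^sub>m m 1) (0\<^sub>m m m)" by (rule four_block_zero_mat[symmetric])
    finally obtain C where "C \<in> carrier_mat 1 m" and eq:
      "four_block_mat (0\<^sub>m 1 1 ^\<^sub>m k) C (0\<^sub>m m 1) (A' ^\<^sub>m k) =
        four_block_mat (0\<^sub>m 1 1) (0\<^sub>m 1 m) (0\<^sub>m m 1) (0\<^sub>m m m)"
      using pow_block_upper_triangular[OF zero_carrier_mat t A', of k] by metis
    then show ?thesis using four_block_mat_inject[OF eq, of 1 1 m m] \<open>C \<in> carrier_mat 1 m\<close> A' by auto
  qed
  from Suc.IH[OF pair' nil[OF sX Suc.prems(2) r X'] nil[OF sY Suc.prems(3) s Y']]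
  obtain X'' Y'' P' Q' where IH: "similar_mat_wit X' X'' P' Q'" "similar_mat_wit Y' Y'' P' Q'"
    "band m 1 X''" "band m 1 Y''" by blast
  note x = similar_mat_witD2[OF X' IH(1)] and y = similar_mat_witD2[OF Y' IH(2)]
  have lift: "similar_mat_wit (four_block_mat (0\<^sub>m 1 1) t (0\<^sub>m m 1) A')
      (four_block_mat (0\<^sub>m 1 1) (t * P') (0\<^sub>m m 1) A'') (diag2 1 m (1\<^sub>m 1) P') (diag2 1 m (1\<^sub>m 1) Q')"
    if "similar_mat_wit A' A'' P' Q'" "A' \<in> carrier_mat m m" "t \<in> carrier_mat 1 m" for A' A'' t
  proof (rule similar_mat_wit_four_block[OF similar_mat_wit_refl that(1)])
    show "t = 1\<^sub>m 1 * (t * P') * Q'"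
      using that(3) x by (simp add: assoc_mult_mat[of _ 1 m _ m _ m, unfolded One_nat_def])
  qed (use that x in auto)
  have strict: "band (Suc m) 1 (four_block_mat (0\<^sub>m 1 1) t (0\<^sub>m m 1) A)"
    if "band m 1 A" "t \<in> carrier_mat 1 m" for A t
  proof -
    have "four_block_mat (0\<^sub>m 1 1) t (0\<^sub>m m 1) A \<in> carrier_mat (1 + m) (1 + m)"
      using that by (intro four_block_carrier_mat) (auto simp: band_def)
    with that show ?thesis by (auto simp: band_def)
  qed
  have "r * P' \<in> carrier_mat 1 m" "s * P' \<in> carrier_mat 1 m"
    using r s x by (auto intro: mult_carrier_mat)
  with similar_mat_wit_trans[OF sX lift[OF IH(1) X' r]] similar_mat_wit_trans[OF sY lift[OF IH(2) Y' s]]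
    strict[OF IH(3)] strict[OF IH(4)]
  show ?case by blast
qed

text \<open>
  Rounding down is harmless: the inequality already holds before the division.
\<close>

lemma square_div4_superadditive:
  assumes "a > 0" "b > 0"
  shows "(a + 1)\<^sup>2 div 4 + (b + 1)\<^sup>2 div 4 \<le> (a + b + 1 :: nat)\<^sup>2 div 4"
proof -
  have "(a + 1)\<^sup>2 + (b + 1)\<^sup>2 \<le> (a + b + 1)\<^sup>2"
  proof -
    have "(a + b + 1)\<^sup>2 + 1 = (a + 1)\<^sup>2 + (b + 1)\<^sup>2 + 2 * (a * b)"
      by (simp add: power2_eq_square algebra_simps)
    moreover have "a * b > 0" using assms by simp
    ultimately show ?thesis by linarith
  qed
  then show ?thesis by linarith
qed

text \<open>
  Induction on the size. After a shift \<open>X\<close> is singular. If it is nilpotent, the pair can be made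
  strictly upper triangular. Otherwise the Fitting decomposition of \<open>X\<close> also splits \<open>Y\<close>, both blocks
  are smaller, and the bound is superadditive in the size.
\<close>

lemma alg_bound_jordan_pair:
  fixes X :: "'k::{alg_closed_field, field_char_0} mat"
  assumes "jordan_pair n X Y"
  shows "alg_bound n X Y ((n + 1)\<^sup>2 div 4)"
  using assms
proof (induction n arbitrary: X Y rule: less_induct)
  case (less n)
  note pair = less.prems
  from pair have X: "X \<in> carrier_mat n n" and Y: "Y \<in> carrier_mat n n"
    by (auto simp: jordan_pair_def)
  obtain q where q: "Y ^\<^sub>m q = 0\<^sub>m n n" using jordan_pair_nilpotent[OF pair] by blast
  show ?case
  proof (cases "n = 0")
    case True
    then show ?thesis
      using pair X Y by (intro alg_bound_strictly_upper) (auto simp: band_def)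
  next
    case False
    have "degree (char_poly X) > 0" using degree_monic_char_poly[OF X] False by simp
    then obtain e where "poly (char_poly X) e = 0"
      using alg_closed_imp_poly_has_root by blast
    then obtain w where w: "w \<in> carrier_vec n" "w \<noteq> 0\<^sub>v n" "char_matrix X e *\<^sub>v w = 0\<^sub>v n"
      using eigenvalue_root_char_poly[OF X, of e] eigenvalue_char_matrix[OF X, of e] by auto
    define N where "N = X + (- e) \<cdot>\<^sub>m 1\<^sub>m n"
    have N: "N \<in> carrier_mat n n" using X by (simp add: N_def)
    have pairN: "jordan_pair n N Y" unfolding N_def by (rule jordan_pair_shift[OF pair])
    have Nw: "N *\<^sub>v w = 0\<^sub>v n"
      using w(3) X unfolding N_def char_matrix_def by auto
    from fitting_decomposition[OF N] obtain a b M U V k P Q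
      where ab: "a + b = n" and M: "M \<in> carrier_mat a a" "M ^\<^sub>m k = 0\<^sub>m a a"
        and U: "U \<in> carrier_mat b b" "V \<in> carrier_mat b b" "U * V = 1\<^sub>m b" "V * U = 1\<^sub>m b"
        and s: "similar_mat_wit N (diag2 a b M U) P Q"
      unfolding similar_mat_def by blast
    note nn = similar_mat_witD2[OF N s]
    \<comment> \<open>Either the eigenvalue e is the only one, or the space splits into two smaller blocks.\<close>
    have "alg_bound n N Y ((n + 1)\<^sup>2 div 4)"
    proof (cases "b = 0")
      case True
      have "diag2 a b M U ^\<^sub>m k = 0\<^sub>m n n"
        using M U ab True by (subst pow_four_block_mat) (auto intro!: eq_matI)
      then have "N ^\<^sub>m k = 0\<^sub>m n n" using similar_mat_wit_pow_id[OF s, of k] nn by simp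
      from jordan_pair_strictly_triangularizable[OF pairN this q] obtain X' Y' P Q where
        t: "similar_mat_wit N X' P Q" "similar_mat_wit Y Y' P Q" "band n 1 X'" "band n 1 Y'" by blast
      show ?thesis
        by (rule alg_bound_similar[OF N Y t(1,2)])
          (rule alg_bound_strictly_upper[OF jordan_pair_similar[OF pairN t(1,2)] t(3,4)])
    next
      case False
      \<comment> \<open>The eigenvector w lies in the kernel of N, so the nilpotent part is nonzero.\<close>
      have a: "a > 0"
      proof (rule ccontr)
        assume "\<not> a > 0"
        then have [simp]: "a = 0" "b = n" using ab by auto
        have D: "diag2 a b M U = U" using M U by (intro eq_matI) auto
        have "det N = det U"
          using s[unfolded D] by (intro det_similar) (auto simp: similar_mat_def)
        moreover have "det N = 0"
          using det_0_iff_vec_prod_zero_field[OF N] w Nw by blast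
        moreover have "det U * det V = 1"
          using U by (simp flip: det_mult[of U b V])
        ultimately show False by simp
      qed
      define Z where "Z = Q * Y * P"
      have sZ: "similar_mat_wit Y Z P Q"
        unfolding Z_def
        by (rule similar_mat_wit_sym, rule similar_mat_witI[of _ _ n]) (use Y nn in auto)
      have pairZ: "jordan_pair (a + b) (diag2 a b M U) Z"
        using jordan_pair_similar[OF pairN s sZ] ab by simp
      obtain Z1 Z2 where Z12: "Z = diag2 a b Z1 Z2" "jordan_pair a M Z1" "jordan_pair b U Z2"
        by (rule jordan_pair_block_diagonal[OF pairZ M U])
      have "alg_bound a M Z1 ((a + 1)\<^sup>2 div 4)" "alg_bound b U Z2 ((b + 1)\<^sup>2 div 4)"
        using less.IH[OF _ Z12(2)] less.IH[OF _ Z12(3)] ab a False by auto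
      then have "alg_bound (a + b) (diag2 a b M U) Z ((a + 1)\<^sup>2 div 4 + (b + 1)\<^sup>2 div 4)"
        unfolding Z12(1) using Z12(2,3)
        by (intro alg_bound_block_diagonal) (auto simp: jordan_pair_def)
      then have "alg_bound n (diag2 a b M U) Z ((n + 1)\<^sup>2 div 4)"
        using alg_bound_mono[OF _ square_div4_superadditive[of a b]] a False ab by auto
      then show ?thesis by (rule alg_bound_similar[OF N Y s sZ])
    qed
    then show ?thesis unfolding N_def by (rule alg_bound_shift[OF X Y])
  qed
qed

section \<open>Dimensions of spaces of matrices\<close>

definition mat_subspace :: "nat \<Rightarrow> 'k::field mat set \<Rightarrow> bool"
  where "mat_subspace n W \<longleftrightarrow> W \<subseteq> carrier_mat n n \<and> 0\<^sub>m n n \<in> W \<and>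
    (\<forall>a\<in>W. \<forall>b\<in>W. a + b \<in> W) \<and> (\<forall>c. \<forall>a\<in>W. c \<cdot>\<^sub>m a \<in> W)"

abbreviation mat_dim :: "nat \<Rightarrow> 'k::field mat set \<Rightarrow> nat"
  where "mat_dim n W \<equiv> vectorspace.dim class_ring ((module_mat TYPE('k) n n)\<lparr>carrier := W\<rparr>)"

text \<open>
  The link to the dimension of a vector space record. The ambient span of \<open>B\<close> is finite
  dimensional, so Steinitz exchange applies to independent subsets of \<open>W\<close>; independence does not
  depend on whether it is taken in \<open>W\<close>, in the span, or in the space of all matrices.
\<close>

lemma mat_dim_bounds:
  fixes W :: "'k::field mat set"
  assumes W: "mat_subspace n W" and B: "finite B" "B \<subseteq> carrier_mat n n" and WB: "W \<subseteq> mat_span n B"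
  shows "mat_dim n W \<le> card B"
    and "finite A \<Longrightarrow> A \<subseteq> W \<Longrightarrow> \<not> module.lin_dep class_ring (module_mat TYPE('k) n n) A \<Longrightarrow> card A \<le> mat_dim n W"
proof -
  interpret V: vectorspace "class_ring :: 'k ring" "module_mat TYPE('k) n n" by (rule matrix_vs)
  have mod: "module (class_ring :: 'k ring) (module_mat TYPE('k) n n)" by unfold_locales
  have B': "B \<subseteq> carrier (module_mat TYPE('k) n n)" using B(2) by (simp add: module_mat_simps)
  note sub = V.span_is_submodule[OF B']
  have span: "mat_span n B \<subseteq> V.span B"
  proof
    fix a assume "a \<in> mat_span n B"
    then show "a \<in> V.span B"
    proof (induction rule: mat_span.induct)
      case zero
      show ?case using submodule.zero_closed[OF sub] by (simp add: module_mat_simps)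
    next
      case (gen b)
      then show ?case using V.in_own_span[OF B'] by blast
    next
      case (add a b)
      then show ?case using submodule.m_closed[OF sub, of a b] by (simp add: module_mat_simps)
    next
      case (smult a c)
      then show ?case using submodule.smult_closed[OF sub, of c a] by (simp add: module_mat_simps)
    qed
  qed
  have subW: "submodule (class_ring :: 'k ring) W (module_mat TYPE('k) n n)"
    by (rule submodule.intro[OF mod])
      (use W in \<open>auto simp: mat_subspace_def module_mat_simps\<close>)
  \<comment> \<open>The finite-dimensional span of B bounds the size of the independent subsets of W, hence W has a basis.\<close>
  interpret S: vectorspace "class_ring :: 'k ring" "V.vs (V.span B)"
    by (rule V.subspace_is_vs[OF V.span_is_subspace[OF B']])
  interpret T: vectorspace "class_ring :: 'k ring" "V.vs W"
    by (rule V.subspace_is_vs) (simp add: subspace_def subW V.vectorspace_axioms)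
  have BS: "B \<subseteq> V.span B" by (rule V.in_own_span[OF B'])
  have gen: "S.gen_set B" using V.span_li_not_depend(1)[OF BS sub] by simp
  have finS: "S.fin_dim" unfolding S.fin_dim_def using B(1) BS gen by auto
  have dimS: "S.dim \<le> card B" by (rule S.gen_ge_dim[OF B(1) _ gen]) (use BS in simp)
  have li: "finite A \<and> card A \<le> card B" if "A \<subseteq> W" "T.lin_indpt A" for A
  proof -
    have AS: "A \<subseteq> V.span B" using that(1) WB span by blast
    have AC: "A \<subseteq> carrier (V.vs (V.span B))" using AS by simp
    have liS: "S.lin_indpt A"
      using that V.span_li_not_depend(2)[OF that(1) subW] V.span_li_not_depend(2)[OF AS sub] by simp
    show ?thesis
      using S.li_le_dim(1)[OF finS AC liS] le_trans[OF S.li_le_dim(2)[OF finS AC liS] dimS] by (rule conjI)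
  qed
  have "T.lin_indpt {}" by (simp add: T.lin_dep_def)
  then have "\<exists>A. finite A \<and> maximal A (\<lambda>S. S \<subseteq> carrier (V.vs W) \<and> T.lin_indpt S)"
    by (intro maximal_exists[where N = "card B" and B = "{}"] li) auto
  then obtain A where A: "finite A" "maximal A (\<lambda>S. S \<subseteq> carrier (V.vs W) \<and> T.lin_indpt S)"
    by blast
  have basis: "T.basis A" by (rule T.max_li_is_basis[OF A(2)])
  have "T.dim = card A" by (rule T.dim_basis[OF A(1) basis])
  moreover have "card A \<le> card B" using li[of A] basis by (auto simp: T.basis_def)
  ultimately show "T.dim \<le> card B" by simp
  have finT: "T.fin_dim" unfolding T.fin_dim_def using A(1) basis by (auto simp: T.basis_def)
  show "card A \<le> T.dim" if "finite A" "A \<subseteq> W" "V.lin_indpt A" for A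
    using T.li_le_dim(2)[OF finT, of A] that V.span_li_not_depend(2)[OF that(2) subW] by simp
qed

text \<open>
  Independence by a triangular shape: at the pivot entry of one member, all other members of at
  least the same height vanish.
\<close>

lemma pivot_lin_indpt:
  fixes E :: "'i \<Rightarrow> 'k::field mat" and h :: "'i \<Rightarrow> nat"
  assumes fin: "finite I" and E: "\<And>i. i \<in> I \<Longrightarrow> E i \<in> carrier_mat n n"
    and piv: "\<And>i. i \<in> I \<Longrightarrow> r i < n \<and> c i < n \<and> E i $$ (r i, c i) \<noteq> 0"
    and off: "\<And>i k. i \<in> I \<Longrightarrow> k \<in> I \<Longrightarrow> k \<noteq> i \<Longrightarrow> h i \<le> h k \<Longrightarrow> E k $$ (r i, c i) = 0"
  shows "inj_on E I" and "\<not> module.lin_dep class_ring (module_mat TYPE('k) n n) (E ` I)"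
proof -
  show inj: "inj_on E I"
  proof (rule inj_onI, rule ccontr)
    fix i k assume ik: "i \<in> I" "k \<in> I" "E i = E k" "i \<noteq> k"
    show False
    proof (cases "h i \<le> h k")
      case True
      then show False using off[of i k] piv[of i] ik by auto
    next
      case False
      then show False using off[of k i] piv[of k] ik by auto
    qed
  qed
  interpret V: vectorspace "class_ring :: 'k ring" "module_mat TYPE('k) n n" by (rule matrix_vs)
  have carr: "E ` I \<subseteq> carrier (module_mat TYPE('k) n n)" using E by (auto simp: module_mat_simps)
  have entry: "V.lincomb a A \<in> carrier_mat n n \<and> V.lincomb a A $$ (p, q) = (\<Sum>v\<in>A. a v * v $$ (p, q))"
    if "finite A" "A \<subseteq> carrier_mat n n" "p < n" "q < n" for a A p q
    using that(1,2)
  proof (induction A rule: finite_induct)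
    case empty
    then show ?case using that(3,4) by (simp add: V.lincomb_def module_mat_simps)
  next
    case (insert v A)
    have "V.lincomb a (insert v A) = a v \<cdot>\<^sub>m v + V.lincomb a A"
      using insert.hyps insert.prems
      by (subst V.lincomb_insert2) (auto simp: module_mat_simps)
    then show ?case using insert that(3,4) by auto
  qed
  show "V.lin_indpt (E ` I)"
  proof (rule V.finite_lin_indpt2)
    fix a assume z: "V.lincomb a (E ` I) = \<zero>\<^bsub>module_mat TYPE('k) n n\<^esub>"
    show "\<forall>v\<in>E ` I. a v = \<zero>\<^bsub>class_ring\<^esub>"
    proof (rule ccontr)
      assume "\<not> ?thesis"
      then have "\<exists>i. i \<in> I \<and> a (E i) \<noteq> 0" by auto
      \<comment> \<open>Read off the entry of a vanishing combination at the pivot of its term of least height.\<close>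
      then obtain i where i: "i \<in> I" "a (E i) \<noteq> 0"
        and min: "\<And>k. k \<in> I \<Longrightarrow> a (E k) \<noteq> 0 \<Longrightarrow> h i \<le> h k"
        using ex_has_least_nat[of "\<lambda>i. i \<in> I \<and> a (E i) \<noteq> 0" _ h] by blast
      from piv[OF i(1)] have rc: "r i < n" "c i < n" by auto
      have "0 = V.lincomb a (E ` I) $$ (r i, c i)" unfolding z using rc by (simp add: module_mat_simps)
      also have "\<dots> = (\<Sum>v\<in>E ` I. a v * v $$ (r i, c i))"
        using entry[of "E ` I" "r i" "c i" a] rc fin E by auto
      also have "\<dots> = (\<Sum>k\<in>I. a (E k) * E k $$ (r i, c i))" by (simp add: sum.reindex[OF inj])
      also have "\<dots> = (\<Sum>k\<in>{i}. a (E k) * E k $$ (r i, c i))"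
        using fin i off min by (intro sum.mono_neutral_right) fastforce+
      also have "\<dots> \<noteq> 0" using i piv by simp
      finally show False by simp
    qed
  qed (use fin carr in auto)
qed

section \<open>Representations of the Jordan plane\<close>

lemma ring_class_ring: "ring (class_ring :: 'a::ring_1 ring)"
  by (rule class_ring.ring_axioms)

lemma jp_ideal_ideal: "ideal (jp_ideal :: (xy, 'k::field) free_algebra set) class_ring"
  unfolding jp_ideal_def by (rule ring.genideal_ideal[OF ring_class_ring]) simp

lemma jp_class_hom: "jp_class \<in> ring_hom (class_ring :: (xy, 'k::field) free_algebra ring) jordan_plane"
  using ideal.rcos_ring_hom[OF jp_ideal_ideal]
  unfolding jordan_plane_def jp_class_def[abs_def] by simp

lemma jordan_plane_carrier: "carrier jordan_plane = range jp_class"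
  unfolding jordan_plane_def jp_class_def[abs_def] FactRing_simps by auto

lemma jp_class_relation:
  fixes x y :: "(xy, 'k::field) free_algebra"
  defines "x \<equiv> free_gen Gx" and "y \<equiv> free_gen Gy"
  shows "jp_class (x * y) = jp_class (y * x + y * y)"
proof -
  interpret I: ideal "jp_ideal :: (xy, 'k) free_algebra set" class_ring by (rule jp_ideal_ideal)
  let ?r = "x * y - y * x - y\<^sup>2"
  have r: "?r \<in> jp_ideal"
    unfolding jp_ideal_def x_def y_def by (rule ring.genideal_self'[OF ring_class_ring]) simp
  have "jp_class (x * y) = jp_class (?r + (y * x + y * y))" by (simp add: power2_eq_square)
  also have "\<dots> = jp_class ?r \<oplus>\<^bsub>jordan_plane\<^esub> jp_class (y * x + y * y)"
    using ring_hom_add[OF jp_class_hom, of ?r "y * x + y * y"] by simp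
  also have "jp_class ?r = jp_class 0"
    using I.a_rcos_const[OF r] I.a_rcos_const[OF I.zero_closed] by (simp add: jp_class_def)
  also have "jp_class 0 \<oplus>\<^bsub>jordan_plane\<^esub> jp_class (y * x + y * y) = jp_class (0 + (y * x + y * y))"
    using ring_hom_add[OF jp_class_hom, of 0 "y * x + y * y"] by simp
  finally show ?thesis by simp
qed

text \<open>
  Elements of the free algebra are finite sums of scaled words.
\<close>

lemma free_algebra_induct [case_names zero add_word]:
  fixes p :: "('a, 'k::field) free_algebra"
  assumes "P 0" "\<And>p w c. P p \<Longrightarrow> P (p + Poly_Mapping.single (Word w) c)"
  shows "P p"
proof (induction p rule: update_induct)
  case (update f a b)
  obtain w where a: "a = Word w" by (cases a)
  have "Poly_Mapping.update a b f = f + Poly_Mapping.single a b"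
    using update(1) by (intro poly_mapping_eqI)
      (auto simp: lookup_update lookup_add lookup_single in_keys_iff when_def)
  then show ?case using assms(2)[OF update(3)] by (simp add: a)
qed (rule assms(1))

lemma single_word_Cons:
  "Poly_Mapping.single (Word (g # w)) (1::'k::field) = free_gen g * Poly_Mapping.single (Word w) 1"
  by (simp add: free_gen_def mult_single)

lemma single_word_scalar:
  "Poly_Mapping.single (Word w) (c::'k::field) = free_scalar c * Poly_Mapping.single (Word w) 1"
  by (simp add: free_scalar_def mult_single zero_free_monoid_def)

text \<open>
  A representation is studied through its composition \<open>\<phi>\<close> with the projection from the free
  algebra, which lives on a type and therefore needs no carrier conditions.
\<close>

locale jp_rep =
  fixes n :: nat and \<rho> :: "(xy, 'k::field) free_algebra set \<Rightarrow> 'k mat"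
  assumes rep: "jp_representation n \<rho>"
begin

definition \<phi> :: "(xy, 'k) free_algebra \<Rightarrow> 'k mat" where "\<phi> p = \<rho> (jp_class p)"

lemma \<phi>_carrier [simp]: "\<phi> p \<in> carrier_mat n n"
  and \<phi>_add: "\<phi> (p + q) = \<phi> p + \<phi> q"
  and \<phi>_mult: "\<phi> (p * q) = \<phi> p * \<phi> q"
  and \<phi>_one: "\<phi> 1 = 1\<^sub>m n"
proof -
  from rep have \<rho>: "\<rho> \<in> ring_hom jordan_plane (ring_mat TYPE('k) n ())"
    by (simp add: jp_representation_def)
  have c: "jp_class p \<in> carrier jordan_plane" for p :: "(xy, 'k) free_algebra"
    by (simp add: jordan_plane_carrier)
  show "\<phi> p \<in> carrier_mat n n"
    using ring_hom_closed[OF \<rho> c] by (simp add: \<phi>_def ring_mat_simps)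
  show "\<phi> (p + q) = \<phi> p + \<phi> q"
    using ring_hom_add[OF jp_class_hom, of p q] ring_hom_add[OF \<rho> c c, of p q]
    by (simp add: \<phi>_def ring_mat_simps)
  show "\<phi> (p * q) = \<phi> p * \<phi> q"
    using ring_hom_mult[OF jp_class_hom, of p q] ring_hom_mult[OF \<rho> c c, of p q]
    by (simp add: \<phi>_def ring_mat_simps)
  show "\<phi> 1 = 1\<^sub>m n"
    using ring_hom_one[OF jp_class_hom[where 'k = 'k]] ring_hom_one[OF \<rho>] by (simp add: \<phi>_def ring_mat_simps)
qed

lemma \<phi>_scalar: "\<phi> (free_scalar c * p) = c \<cdot>\<^sub>m \<phi> p"
proof -
  have "\<rho> (jp_class (free_scalar c) \<otimes>\<^bsub>jordan_plane\<^esub> jp_class p) = c \<cdot>\<^sub>m \<phi> p"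
    using rep by (simp add: jp_representation_def jordan_plane_carrier \<phi>_def)
  then show ?thesis
    using ring_hom_mult[OF jp_class_hom, of "free_scalar c" p] by (simp add: \<phi>_def)
qed

lemma image_algebra_eq: "image_algebra \<rho> = range \<phi>"
  by (auto simp: image_algebra_def jordan_plane_carrier \<phi>_def)

lemma pair: "jordan_pair n (\<phi> (free_gen Gx)) (\<phi> (free_gen Gy))"
proof -
  have "\<phi> (free_gen Gx * free_gen Gy) =
      \<phi> (free_gen Gy * free_gen Gx + free_gen Gy * free_gen Gy)"
    by (simp only: \<phi>_def jp_class_relation)
  then show ?thesis by (simp add: jordan_pair_def \<phi>_mult \<phi>_add)
qed

lemma \<phi>_zero: "\<phi> 0 = 0\<^sub>m n n"
  using \<phi>_scalar[of 0 1] by (auto simp: free_scalar_def \<phi>_one)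

lemma mat_subspace_image: "mat_subspace n (image_algebra \<rho>)"
proof -
  have "\<phi> p + \<phi> q \<in> range \<phi>" "c \<cdot>\<^sub>m \<phi> p \<in> range \<phi>" "0\<^sub>m n n \<in> range \<phi>" for p q c
    unfolding \<phi>_add[symmetric] \<phi>_scalar[symmetric] \<phi>_zero[symmetric] by (rule rangeI)+
  then show ?thesis unfolding mat_subspace_def image_algebra_eq by auto
qed

text \<open>
  The image of each word is a product of the images of the two generators.
\<close>

lemma image_subset_gen_alg:
  "image_algebra \<rho> \<subseteq> gen_alg n (\<phi> (free_gen Gx)) (\<phi> (free_gen Gy))"
proof -
  let ?G = "gen_alg n (\<phi> (free_gen Gx)) (\<phi> (free_gen Gy))"
  have word: "\<phi> (Poly_Mapping.single (Word w) 1) \<in> ?G" for w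
  proof (induction w)
    case Nil
    show ?case using gen_alg.one \<phi>_one by (metis single_one zero_free_monoid_def)
  next
    case (Cons g w)
    then show ?case
      by (cases g) (auto simp: single_word_Cons \<phi>_mult intro: gen_alg.multX gen_alg.multY)
  qed
  have "\<phi> p \<in> ?G" for p
  proof (induction p rule: free_algebra_induct)
    case zero
    have "0\<^sub>m n n = 0 \<cdot>\<^sub>m (1\<^sub>m n :: 'k mat)" by auto
    then show ?case unfolding \<phi>_zero using gen_alg.smult[OF gen_alg.one] by metis
  next
    case (add_word p w c)
    then show ?case
      by (subst single_word_scalar) (auto simp: \<phi>_add \<phi>_scalar intro!: gen_alg.add gen_alg.smult word)
  qed
  then show ?thesis by (auto simp: image_algebra_eq)
qed

lemma image_dim_le:
  assumes "alg_bound n (\<phi> (free_gen Gx)) (\<phi> (free_gen Gy)) c"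
  shows "image_dim n \<rho> \<le> c"
proof -
  from assms obtain B where B: "finite B" "B \<subseteq> carrier_mat n n" "card B \<le> c"
    "gen_alg n (\<phi> (free_gen Gx)) (\<phi> (free_gen Gy)) \<subseteq> mat_span n B" by (auto simp: alg_bound_def)
  have "mat_dim n (image_algebra \<rho>) \<le> card B"
    using mat_dim_bounds(1)[OF mat_subspace_image B(1,2)] image_subset_gen_alg B(4) by blast
  with B(3) show ?thesis by (simp add: image_dim_def)
qed

end

primrec word_mat :: "nat \<Rightarrow> 'k::field mat \<Rightarrow> 'k mat \<Rightarrow> xy list \<Rightarrow> 'k mat" where
  "word_mat n X Y [] = 1\<^sub>m n"
| "word_mat n X Y (g # w) = (case g of Gx \<Rightarrow> X | Gy \<Rightarrow> Y) * word_mat n X Y w"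

text \<open>
  The sum is taken entrywise, because matrices of a fixed size do not form a type on which
  \<^const>\<open>sum\<close> could be used.
\<close>

definition eval_mat :: "nat \<Rightarrow> 'k::field mat \<Rightarrow> 'k mat \<Rightarrow> (xy, 'k) free_algebra \<Rightarrow> 'k mat" where
  "eval_mat n X Y p = mat n n (\<lambda>q. \<Sum>u\<in>Poly_Mapping.keys p.
    Poly_Mapping.lookup p u * (case u of Word w \<Rightarrow> word_mat n X Y w $$ q))"

lemma eval_mat_carrier [simp]: "eval_mat n X Y p \<in> carrier_mat n n"
  by (simp add: eval_mat_def)

lemma eval_mat_index:
  assumes "finite S" "Poly_Mapping.keys p \<subseteq> S" "i < n" "j < n"
  shows "eval_mat n X Y p $$ (i, j) = (\<Sum>u\<in>S.
    Poly_Mapping.lookup p u * (case u of Word w \<Rightarrow> word_mat n X Y w $$ (i, j)))"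
  using assms unfolding eval_mat_def
  by (auto simp: in_keys_iff intro!: sum.mono_neutral_left)

lemma eval_mat_add: "eval_mat n X Y (p + q) = eval_mat n X Y p + eval_mat n X Y q"
proof (rule eq_matI)
  fix i j assume ij: "i < dim_row (eval_mat n X Y p + eval_mat n X Y q)"
    "j < dim_col (eval_mat n X Y p + eval_mat n X Y q)"
  then have ij: "i < n" "j < n" by (auto simp: eval_mat_def)
  let ?S = "Poly_Mapping.keys p \<union> Poly_Mapping.keys q"
  have "Poly_Mapping.keys (p + q) \<subseteq> ?S" by (rule keys_add)
  then show "eval_mat n X Y (p + q) $$ (i, j) = (eval_mat n X Y p + eval_mat n X Y q) $$ (i, j)"
    using ij eval_mat_index[of ?S p i n j X Y] eval_mat_index[of ?S q i n j X Y]
      eval_mat_index[of ?S "p + q" i n j X Y] carrier_matD[OF eval_mat_carrier[of n X Y q]]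
    by (simp add: lookup_add algebra_simps sum.distrib)
qed (auto simp: eval_mat_def)

lemma eval_mat_zero: "eval_mat n X Y 0 = 0\<^sub>m n n"
  by (auto simp: eval_mat_def)

lemma one_smult_mat [simp]: "1 \<cdot>\<^sub>m (A :: 'k::field mat) = A"
  by auto

lemma smult_smult_times: "a \<cdot>\<^sub>m (b \<cdot>\<^sub>m (A :: 'k::field mat)) = (a * b) \<cdot>\<^sub>m A"
  by auto

context
  fixes n :: nat and X Y :: "'k::field mat"
  assumes X [simp]: "X \<in> carrier_mat n n" and Y [simp]: "Y \<in> carrier_mat n n"
begin

lemma word_mat_carrier [simp]: "word_mat n X Y w \<in> carrier_mat n n"
  by (induction w) (auto split: xy.splits)

lemma word_mat_append: "word_mat n X Y (v @ w) = word_mat n X Y v * word_mat n X Y w"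
  by (induction v)
    (auto simp: mult_assoc_square[of _ n] left_mult_one_mat[of _ n n] split: xy.splits)

lemma eval_mat_single: "eval_mat n X Y (Poly_Mapping.single (Word w) c) = c \<cdot>\<^sub>m word_mat n X Y w"
  using carrier_matD[OF word_mat_carrier[of w]] by (intro eq_matI) (auto simp: eval_mat_def)

lemma eval_mat_mult_single:
  "eval_mat n X Y (Poly_Mapping.single (Word v) c * q) =
    eval_mat n X Y (Poly_Mapping.single (Word v) c) * eval_mat n X Y q"
proof (induction q rule: free_algebra_induct)
  case zero
  show ?case by (simp add: eval_mat_zero right_mult_zero_mat[of _ n n])
next
  case (add_word q w d)
  then show ?case
    by (simp add: distrib_left eval_mat_add mult_single eval_mat_single word_mat_append
        mult_add_distrib_mat[of _ n n _ n] mult_smult_distrib[of _ n n _ n]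
        mult_smult_assoc_mat[of _ n n _ n] smult_smult_times mult.commute)
qed

lemma eval_mat_mult: "eval_mat n X Y (p * q) = eval_mat n X Y p * eval_mat n X Y q"
proof (induction p rule: free_algebra_induct)
  case zero
  show ?case by (simp add: eval_mat_zero left_mult_zero_mat[of _ n n])
next
  case (add_word p w c)
  then show ?case
    by (simp add: distrib_right eval_mat_add eval_mat_mult_single add_mult_distrib_mat[of _ n n _ _ n])
qed

lemma eval_mat_one: "eval_mat n X Y 1 = 1\<^sub>m n"
proof -
  have "1 = Poly_Mapping.single (Word []) (1 :: 'k)" by (simp flip: single_one zero_free_monoid_def)
  then show ?thesis using eval_mat_single[of "[]" 1] by (metis one_smult_mat word_mat.simps(1))
qed

lemma eval_mat_gen: "eval_mat n X Y (free_gen Gx) = X" "eval_mat n X Y (free_gen Gy) = Y"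
  by (simp_all add: free_gen_def eval_mat_single right_mult_one_mat[of _ n n])

lemma eval_mat_scalar: "eval_mat n X Y (free_scalar c * p) = c \<cdot>\<^sub>m eval_mat n X Y p"
  by (simp add: free_scalar_def zero_free_monoid_def eval_mat_mult_single eval_mat_single
      mult_smult_assoc_mat[of _ n n _ n] left_mult_one_mat[of _ n n])

lemma eval_mat_ideal:
  assumes rel: "X * Y = Y * X + Y * Y" and p: "p \<in> jp_ideal"
  shows "eval_mat n X Y p = 0\<^sub>m n n"
proof -
  let ?S = "ring_mat TYPE('k) n ()" and ?f = "eval_mat n X Y"
  interpret S: ring ?S by (rule ring_mat)
  interpret f: ring_hom_ring "class_ring :: (xy, 'k) free_algebra ring" ?S ?f
    by (rule ring_hom_ringI2)
      (auto simp: class_ring.ring_axioms S.ring_axioms ring_hom_def ring_mat_simps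
        eval_mat_add eval_mat_mult eval_mat_one)
  let ?x = "free_gen Gx :: (xy, 'k) free_algebra" and ?y = "free_gen Gy :: (xy, 'k) free_algebra"
  have "?f (?x * ?y) = ?f ((?x * ?y - ?y * ?x - ?y\<^sup>2) + (?y * ?x + ?y * ?y))"
    by (simp add: power2_eq_square)
  then have "X * Y = ?f (?x * ?y - ?y * ?x - ?y\<^sup>2) + X * Y"
    unfolding eval_mat_add eval_mat_mult eval_mat_gen rel .
  then have r: "?f (?x * ?y - ?y * ?x - ?y\<^sup>2) = 0\<^sub>m n n"
  proof -
    assume *: "X * Y = ?f (?x * ?y - ?y * ?x - ?y\<^sup>2) + X * Y"
    have "?f (?x * ?y - ?y * ?x - ?y\<^sup>2) $$ (i, j) = 0" if "i < n" "j < n" for i j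
      using arg_cong[OF *, of "\<lambda>A. A $$ (i, j)"] that carrier_matD[OF X] carrier_matD[OF Y]
      by (simp del: index_mult_mat(1))
    then show ?thesis using carrier_matD[OF eval_mat_carrier[of n X Y]] by (intro eq_matI) auto
  qed
  have kernel: "a_kernel class_ring ?S ?f = {p. ?f p = 0\<^sub>m n n}"
    unfolding a_kernel_def' by (simp add: ring_mat_simps)
  have "jp_ideal \<subseteq> {p. ?f p = 0\<^sub>m n n}"
    unfolding jp_ideal_def
    by (rule ring.genideal_minimal[OF ring_class_ring f.kernel_is_ideal[unfolded kernel]])
      (use r in blast)
  with p show ?thesis by blast
qed

text \<open>
  The universal property of the quotient by the relation: evaluation at the pair vanishes on the
  ideal, so it descends to cosets.
\<close>

lemma representation_of_jordan_pair:
  assumes rel: "X * Y = Y * X + Y * Y"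
  shows "\<exists>\<rho>. jp_representation n \<rho> \<and> (\<forall>p. \<rho> (jp_class p) = eval_mat n X Y p)"
proof -
  interpret I: ideal "jp_ideal :: (xy, 'k) free_algebra set" class_ring by (rule jp_ideal_ideal)
  have wd: "eval_mat n X Y p = eval_mat n X Y q" if "jp_class p = jp_class q" for p q
  proof -
    have "p \<in> jp_class p"
      unfolding jp_class_def by (rule I.a_rcos_self) simp
    then have "p \<in> jp_class q" by (simp only: that)
    then obtain i where "i \<in> jp_ideal" "p = i + q" by (auto simp: jp_class_def a_r_coset_def')
    then show ?thesis using eval_mat_ideal[OF rel] by (simp add: eval_mat_add)
  qed
  \<comment> \<open>The choice of a representative in the coset C is immaterial by the previous step.\<close>
  define \<rho> where "\<rho> C = eval_mat n X Y (SOME p. jp_class p = C)" for C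
  have \<rho>: "\<rho> (jp_class p) = eval_mat n X Y p" for p
    unfolding \<rho>_def by (rule wd, rule someI) (rule refl)
  have hom: "jp_class p \<otimes>\<^bsub>jordan_plane\<^esub> jp_class q = jp_class (p * q)"
    "jp_class p \<oplus>\<^bsub>jordan_plane\<^esub> jp_class q = jp_class (p + q)"
    "\<one>\<^bsub>jordan_plane\<^esub> = jp_class (1 :: (xy, 'k) free_algebra)" for p q :: "(xy, 'k) free_algebra"
    using ring_hom_mult[OF jp_class_hom, of p q] ring_hom_add[OF jp_class_hom, of p q]
      ring_hom_one[OF jp_class_hom[where 'k = 'k]] by simp_all
  have "\<rho> \<in> ring_hom jordan_plane (ring_mat TYPE('k) n ())"
    by (auto simp: ring_hom_def jordan_plane_carrier \<rho> hom ring_mat_simps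
        eval_mat_add eval_mat_mult eval_mat_one)
  moreover have "\<rho> (jp_class (free_scalar c) \<otimes>\<^bsub>jordan_plane\<^esub> a) = c \<cdot>\<^sub>m \<rho> a"
    if "a \<in> carrier jordan_plane" for c a
    using that by (auto simp: jordan_plane_carrier \<rho> hom eval_mat_scalar)
  ultimately have "jp_representation n \<rho>" by (simp add: jp_representation_def)
  with \<rho> show ?thesis by blast
qed

end

section \<open>The full Jordan block attains the bound\<close>

text \<open>
  Weights on a single superdiagonal. Such matrices are graded by \<open>s\<close>, and products within this
  grading are explicit.
\<close>

definition offdiag :: "nat \<Rightarrow> nat \<Rightarrow> (nat \<Rightarrow> 'k::field) \<Rightarrow> 'k mat"
  where "offdiag n s f = mat n n (\<lambda>(a, b). if b = a + s then f a else 0)"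

lemma offdiag_carrier [simp]: "offdiag n s f \<in> carrier_mat n n"
  by (simp add: offdiag_def)

lemma offdiag_mult: "offdiag n s f * offdiag n t g = offdiag n (s + t) (\<lambda>a. f a * g (a + s))"
proof (rule eq_matI)
  fix a b assume "a < dim_row (offdiag n (s + t) (\<lambda>a. f a * g (a + s)))"
    "b < dim_col (offdiag n (s + t) (\<lambda>a. f a * g (a + s)))"
  then have ab: "a < n" "b < n" by (auto simp: offdiag_def)
  have "(offdiag n s f * offdiag n t g) $$ (a, b) =
      (\<Sum>k<n. (if k = a + s then f a else 0) * (if b = k + t then g k else 0))"
    using ab by (auto simp: offdiag_def scalar_prod_def lessThan_atLeast0)
  also have "\<dots> = (\<Sum>k<n. if k = a + s then f a * (if b = k + t then g k else 0) else 0)"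
    by (intro sum.cong) auto
  also have "\<dots> = (if a + s < n then f a * (if b = a + s + t then g (a + s) else 0) else 0)"
    by simp
  also have "\<dots> = offdiag n (s + t) (\<lambda>a. f a * g (a + s)) $$ (a, b)"
    using ab by (auto simp: offdiag_def add.assoc)
  finally show "(offdiag n s f * offdiag n t g) $$ (a, b) =
    offdiag n (s + t) (\<lambda>a. f a * g (a + s)) $$ (a, b)" .
qed (auto simp: offdiag_def)

lemma offdiag_pow: "offdiag n 1 f ^\<^sub>m k = offdiag n k (\<lambda>a. \<Prod>l<k. f (a + l))"
proof (induction k)
  case 0
  show ?case by (auto simp: offdiag_def)
next
  case (Suc k)
  then show ?case by (simp add: offdiag_mult mult.commute)
qed

text \<open>
  On \<open>k[t] / (t\<^sup>n)\<close> with the monomial basis in decreasing degree, where the full block is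
  multiplication by \<open>t\<close>, this is the operator \<open>t\<^sup>2 d/dt - (n - 1) t\<close>.
\<close>

definition full_block_x :: "nat \<Rightarrow> 'k::field mat"
  where "full_block_x n = offdiag n 1 (\<lambda>a. - of_nat (a + 1))"

lemma jordan_block_offdiag: "jordan_block n 0 = offdiag n 1 (\<lambda>_. 1 :: 'k::field)"
  by (auto simp: offdiag_def)

lemma jordan_pair_full_block: "jordan_pair n (full_block_x n) (jordan_block n (0 :: 'k::field))"
  unfolding jordan_pair_def full_block_x_def jordan_block_offdiag offdiag_mult
  by (auto simp: offdiag_def)

text \<open>
  An element of degree \<open>d\<close> of the image algebra. Its weight in row \<open>a\<close> is, after reversing the
  order of the factors, the product of \<open>i - a\<close> over \<open>i < j\<close>: it vanishes for \<open>a < j\<close> and not for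
  \<open>a = j\<close>. This is the triangular shape needed for independence.
\<close>

lemma full_block_product:
  assumes "j \<le> d"
  shows "jordan_block n 0 ^\<^sub>m (d - j) * (full_block_x n + of_nat d \<cdot>\<^sub>m jordan_block n 0) ^\<^sub>m j =
    offdiag n d (\<lambda>a. \<Prod>l<j. of_nat d - of_nat (a + (d - j) + l + 1) :: 'k::field)"
proof -
  have "full_block_x n + of_nat d \<cdot>\<^sub>m jordan_block n 0 =
      offdiag n 1 (\<lambda>a. of_nat d - of_nat (a + 1) :: 'k)"
    by (auto simp: full_block_x_def offdiag_def)
  then show ?thesis
    unfolding jordan_block_offdiag using assms
    by (simp add: offdiag_pow offdiag_mult[of n "d - j" _ j] algebra_simps del: One_nat_def)
qed

text \<open>
  A pair \<open>(j, d)\<close> stands for the pivot in row \<open>j\<close> on the \<open>d\<close>-th superdiagonal. The condition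
  \<open>j \<le> d\<close> says that the product of degree \<open>d\<close> has room for \<open>j\<close> factors involving \<open>X\<close>, and
  \<open>d + j < n\<close> says that the pivot lies inside the matrix.
\<close>

definition pivots :: "nat \<Rightarrow> (nat \<times> nat) set" where "pivots n = {(j, d). j \<le> d \<and> d + j < n}"

lemma finite_pivots [simp]: "finite (pivots n)"
  by (rule finite_subset[of _ "{..<n} \<times> {..<n}"]) (auto simp: pivots_def)

text \<open>
  Passing from \<open>n\<close> to \<open>n + 1\<close> adds the pairs with \<open>d + j = n\<close>, one for each \<open>j \<le> n / 2\<close>.
\<close>

lemma card_pivots: "card (pivots n) = (n + 1)\<^sup>2 div 4"
proof (induction n)
  case 0
  show ?case by (simp add: pivots_def)
next
  case (Suc n)
  let ?new = "(\<lambda>j. (j, n - j)) ` {..n div 2}"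
  have "pivots (Suc n) = pivots n \<union> ?new"
    by (auto simp: pivots_def image_iff)
  moreover have "pivots n \<inter> ?new = {}" by (auto simp: pivots_def)
  moreover have "card ?new = n div 2 + 1" by (subst card_image) (auto simp: inj_on_def)
  ultimately have "card (pivots (Suc n)) = (n + 1)\<^sup>2 div 4 + (n div 2 + 1)"
    by (simp add: card_Un_disjoint Suc)
  also have "\<dots> = (Suc n + 1)\<^sup>2 div 4"
  proof (cases "even n")
    case True
    then obtain k where k: "n = 2 * k" by (elim evenE)
    then show ?thesis using odd_square_div4[of k] even_square_div4[of k] by simp
  next
    case False
    then obtain k where k: "n = 2 * k + 1" by (elim oddE)
    then show ?thesis using odd_square_div4[of "k + 1"] even_square_div4[of k] by simp
  qed
  finally show ?case .
qed

lemma (in jp_rep) \<phi>_pow: "\<phi> (p ^ k) = \<phi> p ^\<^sub>m k"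
  using carrier_matD[OF \<phi>_carrier[of p]]
  by (induction k) (simp_all add: \<phi>_one \<phi>_mult power_Suc2 del: power_Suc)

text \<open>
  The pivot elements are images of explicit elements of the free algebra and are independent by
  their triangular shape on each superdiagonal. The spanning set from \<open>alg_bound\<close> makes the image
  finite dimensional.
\<close>

lemma (in jp_rep) full_block_dim_ge:
  assumes x: "\<phi> (free_gen Gx) = full_block_x n" and y: "\<phi> (free_gen Gy) = jordan_block n 0"
    and char0: "\<And>k. (of_nat (Suc k) :: 'k) \<noteq> 0" and "alg_bound n (full_block_x n) (jordan_block n 0 :: 'k mat) c"
  shows "(n + 1)\<^sup>2 div 4 \<le> image_dim n \<rho>"
proof -
  define E where "E = (\<lambda>(j, d). offdiag n d (\<lambda>a. \<Prod>l<j. of_nat d - of_nat (a + (d - j) + l + 1) :: 'k))"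
  define S where "S = E ` pivots n"
  have "E i \<in> image_algebra \<rho>" if "i \<in> pivots n" for i
  proof -
    obtain j d where i: "i = (j, d)" by (cases i)
    with that have "j \<le> d" by (simp add: pivots_def)
    \<comment> \<open>The shift by d makes the coefficient along the d-th superdiagonal vanish in exactly its first j rows.\<close>
    have "\<phi> (free_gen Gx + free_scalar (of_nat d) * free_gen Gy) =
        full_block_x n + of_nat d \<cdot>\<^sub>m jordan_block n 0"
      by (simp only: \<phi>_add \<phi>_scalar x y)
    then have "E i = \<phi> (free_gen Gy ^ (d - j) * (free_gen Gx + free_scalar (of_nat d) * free_gen Gy) ^ j)"
      using full_block_product[OF \<open>j \<le> d\<close>, of n, where 'k = 'k]
      by (simp only: i E_def prod.case \<phi>_mult[of "_ ^ _" "_ ^ _"] \<phi>_pow y)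
    then show ?thesis unfolding image_algebra_eq by blast
  qed
  then have sub: "S \<subseteq> image_algebra \<rho>" by (auto simp: S_def)
  have E1: "E i \<in> carrier_mat n n" if "i \<in> pivots n" for i
    by (auto simp: E_def split: prod.splits)
  have E2: "fst i < n \<and> snd i + fst i < n \<and> E i $$ (fst i, snd i + fst i) \<noteq> 0" if "i \<in> pivots n" for i
  proof -
    obtain j d where i: "i = (j, d)" by (cases i)
    with that have jd: "j \<le> d" "d + j < n" by (auto simp: pivots_def)
    then have "E i $$ (j, d + j) = (\<Prod>l<j. of_nat d - of_nat (j + (d - j) + l + 1))"
      by (simp add: E_def i offdiag_def add.commute)
    also have "\<dots> = (\<Prod>l<j. - of_nat (Suc l))"
      using jd by (intro prod.cong) auto
    also have "\<dots> \<noteq> 0" using char0 by (simp only: prod_zero_iff finite_lessThan neg_equal_0_iff_equal) blast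
    finally show ?thesis using jd by (simp add: i)
  qed
  have E3: "E k $$ (fst i, snd i + fst i) = 0"
    if "i \<in> pivots n" "k \<in> pivots n" "k \<noteq> i" "fst i \<le> fst k" for i k
  proof -
    obtain j d where i: "i = (j, d)" by (cases i)
    obtain j' d' where k: "k = (j', d')" by (cases k)
    from that have jd: "j \<le> d" "d + j < n" "j' \<le> d'" "d' + j' < n" "j \<le> j'" "d' \<noteq> d \<or> j < j'"
      by (auto simp: i k pivots_def)
    show ?thesis
    proof (cases "d' = d")
      case False
      then show ?thesis using jd by (simp add: E_def i k offdiag_def)
    next
      case True
      with jd have "j < j'" by simp
      \<comment> \<open>The factor with index j' - j - 1 is zero.\<close>
      then have "j + (d - j') + (j' - j - 1) + 1 = d" "j' - j - 1 < j'" using jd True by auto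
      then have "(\<Prod>l<j'. of_nat d - of_nat (j + (d - j') + l + 1) :: 'k) = 0"
        by (intro prod_zero bexI[of _ "j' - j - 1"]) auto
      then show ?thesis using jd True by (simp add: E_def i k offdiag_def add.commute)
    qed
  qed
  note li = pivot_lin_indpt[where I = "pivots n" and E = E and n = n and r = fst
      and c = "\<lambda>i. snd i + fst i" and h = fst, OF finite_pivots E1 E2 E3]
  from assms(4) obtain B where B: "finite B" "B \<subseteq> carrier_mat n n"
    "gen_alg n (full_block_x n) (jordan_block n (0 :: 'k)) \<subseteq> mat_span n B" by (auto simp: alg_bound_def)
  have "card S \<le> image_dim n \<rho>"
    unfolding image_dim_def
    by (rule mat_dim_bounds(2)[OF mat_subspace_image B(1,2)])
      (use image_subset_gen_alg[unfolded x y] B(3) sub li(2) in \<open>auto simp: S_def\<close>)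
  moreover have "card S = (n + 1)\<^sup>2 div 4"
    using card_image[OF li(1)] card_pivots[of n] by (simp add: S_def)
  ultimately show ?thesis by simp
qed

lemma real_square_div4:
  "even n \<Longrightarrow> real ((n + 1)\<^sup>2 div 4) = real n * (real n + 2) / 4"
  "odd n \<Longrightarrow> real ((n + 1)\<^sup>2 div 4) = (real n + 1)\<^sup>2 / 4"
proof -
  assume "even n"
  then obtain k where k: "n = 2 * k" by (elim evenE)
  show "real ((n + 1)\<^sup>2 div 4) = real n * (real n + 2) / 4"
    unfolding k odd_square_div4 by (simp add: algebra_simps)
next
  assume "odd n"
  then obtain k where k: "n = 2 * k + 1" by (elim oddE)
  then have "(n + 1)\<^sup>2 div 4 = (k + 1) * (k + 1)" using even_square_div4[of k] by simp
  then show "real ((n + 1)\<^sup>2 div 4) = (real n + 1)\<^sup>2 / 4"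
    by (simp add: k power2_eq_square algebra_simps)
qed

lemma image_dim_le_square_div4:
  fixes \<rho> :: "(xy, 'k::{alg_closed_field, field_char_0}) free_algebra set \<Rightarrow> 'k mat"
  assumes "jp_representation n \<rho>"
  shows "image_dim n \<rho> \<le> (n + 1)\<^sup>2 div 4"
proof -
  interpret jp_rep n \<rho> by (rule jp_rep.intro[OF assms])
  show ?thesis by (rule image_dim_le[OF alg_bound_jordan_pair[OF pair]])
qed

lemma exists_full_block_representation:
  assumes "n \<ge> 1"
  shows "\<exists>\<rho> :: (xy, 'k::{alg_closed_field, field_char_0}) free_algebra set \<Rightarrow> 'k mat.
    jp_representation n \<rho> \<and> jordan_nf (\<rho> jp_y) [(n, 0)] \<and> image_dim n \<rho> = (n + 1)\<^sup>2 div 4"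
proof -
  let ?X = "full_block_x n :: 'k mat" and ?Y = "jordan_block n 0 :: 'k mat"
  from jordan_pair_full_block[of n, where 'k = 'k]
  have XY: "?X \<in> carrier_mat n n" "?Y \<in> carrier_mat n n" "?X * ?Y = ?Y * ?X + ?Y * ?Y"
    by (auto simp: jordan_pair_def)
  from representation_of_jordan_pair[OF XY] obtain \<rho> where
    \<rho>: "jp_representation n \<rho>" "\<And>p. \<rho> (jp_class p) = eval_mat n ?X ?Y p" by blast
  interpret jp_rep n \<rho> by (rule jp_rep.intro[OF \<rho>(1)])
  have gens: "\<phi> (free_gen Gx) = ?X" "\<phi> (free_gen Gy) = ?Y"
    using eval_mat_gen[OF XY(1,2)] by (simp_all add: \<phi>_def \<rho>(2))
  have "(n + 1)\<^sup>2 div 4 \<le> image_dim n \<rho>"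
    by (rule full_block_dim_ge[OF gens _ alg_bound_jordan_pair[OF jordan_pair_full_block]])
      (simp del: of_nat_Suc)
  with image_dim_le_square_div4[OF \<rho>(1)] have "image_dim n \<rho> = (n + 1)\<^sup>2 div 4" by simp
  moreover have "jordan_nf (\<rho> jp_y) [(n, 0)]"
  proof -
    have "\<rho> jp_y = ?Y" using gens(2) by (simp add: \<phi>_def jp_y_def)
    moreover have "jordan_matrix [(n, 0)] = ?Y"
      by (intro eq_matI) (auto simp: jordan_matrix_def Let_def)
    ultimately show ?thesis
      using assms similar_mat_refl[OF XY(2)] by (simp add: jordan_nf_def)
  qed
  ultimately show ?thesis using \<rho>(1) by blast
qed

theorem theorem10p1:
  fixes n :: nat
  shows "(\<forall>\<rho> :: (xy, 'k::{alg_closed_field, field_char_0}) free_algebra set \<Rightarrow> 'k mat.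
            jp_representation n \<rho> \<longrightarrow>
              (even n \<longrightarrow> real (image_dim n \<rho>) \<le> real n * (real n + 2) / 4) \<and>
              (odd n \<longrightarrow> real (image_dim n \<rho>) \<le> (real n + 1)\<^sup>2 / 4)) \<and>
         (n \<ge> 1 \<longrightarrow>
          (\<exists>\<rho> :: (xy, 'k) free_algebra set \<Rightarrow> 'k mat.
            jp_representation n \<rho> \<and>
            jordan_nf (\<rho> jp_y) [(n, 0)] \<and>
            (even n \<longrightarrow> real (image_dim n \<rho>) = real n * (real n + 2) / 4) \<and>
            (odd n \<longrightarrow> real (image_dim n \<rho>) = (real n + 1)\<^sup>2 / 4)))"
proof (intro conjI allI impI)
  fix \<rho> :: "(xy, 'k) free_algebra set \<Rightarrow> 'k mat"
  assume "jp_representation n \<rho>"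
  then have le: "real (image_dim n \<rho>) \<le> real ((n + 1)\<^sup>2 div 4)"
    using image_dim_le_square_div4 of_nat_le_iff by blast
  show "real (image_dim n \<rho>) \<le> real n * (real n + 2) / 4" if "even n"
    using le real_square_div4(1)[OF that] by simp
  show "real (image_dim n \<rho>) \<le> (real n + 1)\<^sup>2 / 4" if "odd n"
    using le real_square_div4(2)[OF that] by simp
next
  assume "n \<ge> 1"
  from exists_full_block_representation[OF this]
  obtain \<rho> :: "(xy, 'k) free_algebra set \<Rightarrow> 'k mat" where "jp_representation n \<rho>"
    "jordan_nf (\<rho> jp_y) [(n, 0)]" "image_dim n \<rho> = (n + 1)\<^sup>2 div 4" by blast
  then show "\<exists>\<rho> :: (xy, 'k) free_algebra set \<Rightarrow> 'k mat. jp_representation n \<rho> \<and>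
      jordan_nf (\<rho> jp_y) [(n, 0)] \<and>
      (even n \<longrightarrow> real (image_dim n \<rho>) = real n * (real n + 2) / 4) \<and>
      (odd n \<longrightarrow> real (image_dim n \<rho>) = (real n + 1)\<^sup>2 / 4)"
    using real_square_div4 by (intro exI[of _ \<rho>]) simp
qed

end
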